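(* Consider the quantum Ising chain in a transverse field, $H=-J\sum_{i\in\mathbb{Z}}\sigma^x_i\sigma^x_{i+1}-h\sum_{i\in\mathbb{Z}}\sigma^z_i$, in the disordered regime $|J/h|<1$, and let $\omega$ be its unique ground state ($\beta=\infty$). Then the limit $$F(t)=\lim_{n\to\infty}\frac1n\log\omega\Bigl(\exp\bigl(t\textstyle\sum_{i=1}^n\sigma^z_i\bigr)\Bigr)$$ exists for every $t\in\mathbb{R}$ and $F$ is real-analytic in $t$.
   Context: $\sigma^x,\sigma^z$ are Pauli matrices with copies at each site of $\mathbb{Z}$ acting on $\mathbb{C}^2$; $J,h$ are real parameters (with $h\neq 0$). The ground state $\omega$ is the unique weak* limit of the finite-volume ground states as the volume increases to $\mathbb{Z}$. *)

theory Defs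
  imports Complex_Main
begin

text \<open>Finite volume: sites {-L..L} of the integers. A basis configuration of the
  spin chain (sigma^z eigenbasis) is a function s :: int => bool, True meaning
  sigma^z = +1, False meaning sigma^z = -1; sites outside the volume are fixed to
  False (they play no role).  Vectors of the finite-volume Hilbert space
  (C^2)^(tensor Lambda) are functions on configurations; the Hamiltonian is real,
  so its spectrum and ground space are determined by real vectors.\<close>

definition box :: "nat \<Rightarrow> int set" where
  "box L = {- int L .. int L}"

definition configs :: "nat \<Rightarrow> (int \<Rightarrow> bool) set" where
  "configs L = {s. \<forall>i. i \<notin> box L \<longrightarrow> s i = False}"

definition flip :: "int \<Rightarrow> (int \<Rightarrow> bool) \<Rightarrow> (int \<Rightarrow> bool)" where
  "flip i s = s(i := \<not> s i)"

definition zval :: "bool \<Rightarrow> real" where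
  "zval b = (if b then 1 else -1)"

text \<open>Action of the finite-volume (open boundary) Hamiltonian
  H_L = -J sum_{i=-L}^{L-1} sigma^x_i sigma^x_{i+1} - h sum_{i=-L}^{L} sigma^z_i
  on a vector v.\<close>
definition ham :: "real \<Rightarrow> real \<Rightarrow> nat \<Rightarrow> ((int \<Rightarrow> bool) \<Rightarrow> real) \<Rightarrow> ((int \<Rightarrow> bool) \<Rightarrow> real)" where
  "ham J h L v = (\<lambda>s.
      - J * (\<Sum>i\<in>{- int L ..< int L}. v (flip i (flip (i + 1) s)))
      - h * (\<Sum>i\<in>box L. zval (s i)) * v s)"

definition is_eigenvalue :: "real \<Rightarrow> real \<Rightarrow> nat \<Rightarrow> real \<Rightarrow> bool" where
  "is_eigenvalue J h L E \<longleftrightarrow>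
     (\<exists>v. (\<exists>s\<in>configs L. v s \<noteq> 0) \<and> (\<forall>s\<in>configs L. ham J h L v s = E * v s))"

definition ground_energy :: "real \<Rightarrow> real \<Rightarrow> nat \<Rightarrow> real" where
  "ground_energy J h L = Min {E. is_eigenvalue J h L E}"

definition ground_space :: "real \<Rightarrow> real \<Rightarrow> nat \<Rightarrow> ((int \<Rightarrow> bool) \<Rightarrow> real) set" where
  "ground_space J h L =
     {v. \<forall>s\<in>configs L. ham J h L v s = ground_energy J h L * v s}"

text \<open>Diagonal matrix element <e_s, P e_s> of the orthogonal projection P onto the
  ground space: ||P e_s||^2 = sup over unit ground vectors v of |v(s)|^2.\<close>
definition ground_weight :: "real \<Rightarrow> real \<Rightarrow> nat \<Rightarrow> (int \<Rightarrow> bool) \<Rightarrow> real" where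
  "ground_weight J h L s =
     Sup {(v s)^2 | v. v \<in> ground_space J h L \<and> (\<Sum>x\<in>configs L. (v x)^2) = 1}"

text \<open>Finite-volume ground state (beta = infinity: normalized ground projector
  P / tr P) evaluated on a diagonal observable with diagonal entries a.\<close>
definition gs_expect_diag :: "real \<Rightarrow> real \<Rightarrow> nat \<Rightarrow> ((int \<Rightarrow> bool) \<Rightarrow> real) \<Rightarrow> real" where
  "gs_expect_diag J h L a =
     (\<Sum>s\<in>configs L. a s * ground_weight J h L s) / (\<Sum>s\<in>configs L. ground_weight J h L s)"

text \<open>omega(exp(t sum_{i=1}^n sigma^z_i)), where omega is the weak* limit of the
  finite-volume ground states (the observable is diagonal in the sigma^z basis
  with entries exp(t sum_{i=1}^n s_i)).\<close>
definition omega_exp :: "real \<Rightarrow> real \<Rightarrow> real \<Rightarrow> nat \<Rightarrow> real" where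
  "omega_exp J h t n =
     lim (\<lambda>L. gs_expect_diag J h L (\<lambda>s. exp (t * (\<Sum>i\<in>{1..int n}. zval (s i)))))"

definition real_analytic_on :: "(real \<Rightarrow> real) \<Rightarrow> real set \<Rightarrow> bool" where
  "real_analytic_on f S \<longleftrightarrow>
     (\<forall>x\<in>S. \<exists>r>0. \<exists>c::nat \<Rightarrow> real.
        \<forall>y. \<bar>y - x\<bar> < r \<longrightarrow> (\<lambda>k. c k * (y - x) ^ k) sums f y)"

end

theory Submission
  imports "HOL-Complex_Analysis.Complex_Analysis" Defs
begin

text \<open>
  By the Jordan-Wigner transformation the chain is a free fermion system. With the real Majorana
  operators \<open>a\<^sub>k\<close>, \<open>b\<^sub>k = \<sigma>\<^sup>z\<^sub>k a\<^sub>k\<close> the commutators of the Hamiltonian with them are linear, given by a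
  bidiagonal matrix \<open>\<kappa> M\<close>, \<open>\<kappa> = |h| + |J|\<close>. In the gapped regime \<open>M\<^sup>T M = 1 - X\<close> with \<open>X\<close> of row sum
  norm below one, so the polar decomposition of \<open>M\<close> is a convergent power series in \<open>X\<close>, and
  positivity of \<open>H - E\<close> forces every ground vector to satisfy \<open>a\<^sub>k v = - (\<Sum>j. A k j * b\<^sub>j v)\<close> with the
  orthogonal polar factor \<open>A\<close>. This determines \<open>v\<close> up to a scalar.

  Wick's theorem is avoided: the tilted vector \<open>exp (t/2 \<Sum> \<sigma>\<^sup>z) v\<close> satisfies a relation of the same
  kind, from which its two-point function, hence the logarithmic derivative in \<open>t\<close> of the generating
  function, can be read off. Integration gives, with \<open>A\<^sub>n\<close> the compression of \<open>A\<close> to \<open>{1..n}\<close>,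
  \<open>ln \<omega>(exp (t \<Sum> \<sigma>\<^sup>z)) = n ln (cosh t) + (\<Sum>j\<ge>1. (-1)\<^sup>j\<^sup>-\<^sup>1 / j * tanh\<^sup>j t * tr A\<^sub>n\<^sup>j)\<close>.
  As \<open>A\<^sub>n\<close> is a contraction the traces are at most \<open>n\<close> and the series converges for all real \<open>t\<close>. In
  infinite volume \<open>A\<^sub>n\<close> is a Toeplitz matrix with summable symbol, so the traces divided by \<open>n\<close>
  converge, and the limit is a power series in \<open>tanh t\<close> of radius at least one.
\<close>

section \<open>Matrices indexed by finite sets of integers\<close>

definition mid :: "int \<Rightarrow> int \<Rightarrow> real" where
  "mid i j = (if i = j then 1 else 0)"

text \<open>Matrices are total functions on pairs of integers and the index set is a parameter of
  the product. So one and the same matrix can be compressed to a block, or compared across volumes,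
  without a change of type.\<close>

definition mmul :: "int set \<Rightarrow> (int \<Rightarrow> int \<Rightarrow> real) \<Rightarrow> (int \<Rightarrow> int \<Rightarrow> real) \<Rightarrow> int \<Rightarrow> int \<Rightarrow> real" where
  "mmul I A B i j = (\<Sum>l\<in>I. A i l * B l j)"

fun mpow :: "int set \<Rightarrow> (int \<Rightarrow> int \<Rightarrow> real) \<Rightarrow> nat \<Rightarrow> int \<Rightarrow> int \<Rightarrow> real" where
  "mpow I A 0 = mid"
| "mpow I A (Suc k) = mmul I A (mpow I A k)"

definition contractive :: "int set \<Rightarrow> (int \<Rightarrow> int \<Rightarrow> real) \<Rightarrow> bool" where
  "contractive I A \<longleftrightarrow> (\<forall>y. (\<Sum>i\<in>I. (\<Sum>j\<in>I. A i j * y j)\<^sup>2) \<le> (\<Sum>j\<in>I. (y j)\<^sup>2))"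

lemma mmul_assoc: "mmul I (mmul I A B) C i j = mmul I A (mmul I B C) i j"
proof -
  have "mmul I (mmul I A B) C i j = (\<Sum>l\<in>I. \<Sum>m\<in>I. A i m * B m l * C l j)"
    by (simp add: mmul_def sum_distrib_right)
  also have "\<dots> = (\<Sum>m\<in>I. \<Sum>l\<in>I. A i m * B m l * C l j)"
    by (rule sum.swap)
  also have "\<dots> = mmul I A (mmul I B C) i j"
    by (simp add: mmul_def sum_distrib_left mult.assoc)
  finally show ?thesis .
qed

lemma mmul_cong:
  assumes "\<And>l. l \<in> I \<Longrightarrow> A i l = A' i l" "\<And>l. l \<in> I \<Longrightarrow> B l j = B' l j"
  shows "mmul I A B i j = mmul I A' B' i j"
  unfolding mmul_def using assms by (intro sum.cong) auto

lemma mmul_mid_left: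
  assumes "finite I" "i \<in> I"
  shows "mmul I mid B i j = B i j"
  using assms by (simp add: mmul_def mid_def if_distrib[of "\<lambda>x. x * _"] sum.delta cong: if_cong)

lemma mmul_mid_right:
  assumes "finite I" "j \<in> I"
  shows "mmul I B mid i j = B i j"
  using assms by (simp add: mmul_def mid_def if_distrib[of "\<lambda>x. _ * x"] sum.delta' cong: if_cong)

lemma mid_commute: "mid i j = mid j i"
  by (auto simp: mid_def)

lemma mpow_add:
  assumes "finite I" "i \<in> I"
  shows "mpow I A (m + n) i j = mmul I (mpow I A m) (mpow I A n) i j"
  using assms(2)
proof (induction m arbitrary: i)
  case 0
  then show ?case using assms by (simp add: mmul_mid_left)
next
  case (Suc m)
  have "mpow I A (Suc m + n) i j = mmul I A (mmul I (mpow I A m) (mpow I A n)) i j"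
    using Suc by (auto intro: mmul_cong)
  then show ?case by (simp add: mmul_assoc)
qed

lemma mpow_Suc_right:
  assumes "finite I" "i \<in> I" "j \<in> I"
  shows "mpow I A (Suc k) i j = mmul I (mpow I A k) A i j"
proof -
  have "mpow I A (k + 1) i j = mmul I (mpow I A k) (mmul I A mid) i j"
    using mpow_add[OF assms(1,2), of A k 1] by simp
  also have "\<dots> = mmul I (mpow I A k) A i j"
    using assms by (intro mmul_cong) (auto simp: mmul_mid_right)
  finally show ?thesis by simp
qed

lemma mpow_symmetric:
  assumes "finite I" "\<And>i j. i \<in> I \<Longrightarrow> j \<in> I \<Longrightarrow> A i j = A j i" "i \<in> I" "j \<in> I"
  shows "mpow I A k i j = mpow I A k j i"
  using assms(3,4)
proof (induction k arbitrary: i j)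
  case 0
  then show ?case by (simp add: mid_commute)
next
  case (Suc k)
  have "mpow I A (Suc k) i j = (\<Sum>l\<in>I. A i l * mpow I A k l j)"
    by (simp add: mmul_def)
  also have "\<dots> = (\<Sum>l\<in>I. mpow I A k j l * A l i)"
    using Suc assms(2) by (intro sum.cong) auto
  also have "\<dots> = mpow I A (Suc k) j i"
    using mpow_Suc_right[OF assms(1) Suc.prems(2,1), of A k] by (simp add: mmul_def)
  finally show ?case .
qed

text \<open>The maximal absolute row sum is a submultiplicative norm. It controls the entries of all
  powers independently of the size of \<open>I\<close>.\<close>

lemma mpow_row_sum_le:
  assumes "finite I" "\<And>i. i \<in> I \<Longrightarrow> (\<Sum>j\<in>I. \<bar>A i j\<bar>) \<le> b" "0 \<le> b" "i \<in> I"
  shows "(\<Sum>j\<in>I. \<bar>mpow I A k i j\<bar>) \<le> b ^ k"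
  using assms(4)
proof (induction k arbitrary: i)
  case 0
  then show ?case using assms(1) by (simp add: mid_def if_distrib[of abs] cong: if_cong)
next
  case (Suc k)
  have "(\<Sum>j\<in>I. \<bar>mpow I A (Suc k) i j\<bar>) \<le> (\<Sum>j\<in>I. \<Sum>l\<in>I. \<bar>A i l\<bar> * \<bar>mpow I A k l j\<bar>)"
    unfolding mpow.simps mmul_def abs_mult[symmetric] by (intro sum_mono sum_abs)
  also have "\<dots> = (\<Sum>l\<in>I. \<bar>A i l\<bar> * (\<Sum>j\<in>I. \<bar>mpow I A k l j\<bar>))"
    by (subst sum.swap) (simp add: sum_distrib_left)
  also have "\<dots> \<le> (\<Sum>l\<in>I. \<bar>A i l\<bar> * b ^ k)"
    using Suc by (intro sum_mono mult_left_mono) auto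
  also have "\<dots> \<le> b * b ^ k"
    using assms(2)[OF Suc.prems] assms(3) by (simp add: sum_distrib_right[symmetric] mult_right_mono)
  finally show ?case by simp
qed

text \<open>Schur test: each product \<open>y i * y j\<close> is split by the inequality of
  arithmetic and geometric means, and the symmetry of \<open>A\<close> turns column sums into row
  sums.\<close>

lemma symmetric_form_le:
  assumes "finite I" "\<And>i j. i \<in> I \<Longrightarrow> j \<in> I \<Longrightarrow> A i j = A j i"
    and "\<And>i. i \<in> I \<Longrightarrow> (\<Sum>j\<in>I. \<bar>A i j\<bar>) \<le> (b::real)"
  shows "(\<Sum>i\<in>I. \<Sum>j\<in>I. A i j * y i * y j) \<le> b * (\<Sum>i\<in>I. (y i)\<^sup>2)"
proof -
  have *: "(\<Sum>i\<in>I. \<Sum>j\<in>I. \<bar>A i j\<bar> * (y i)\<^sup>2) \<le> b * (\<Sum>i\<in>I. (y i)\<^sup>2)"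
    using assms(3) by (auto simp: sum_distrib_left sum_distrib_right[symmetric] intro!: sum_mono mult_right_mono)
  have **: "(\<Sum>i\<in>I. \<Sum>j\<in>I. \<bar>A i j\<bar> * (y j)\<^sup>2) = (\<Sum>i\<in>I. \<Sum>j\<in>I. \<bar>A i j\<bar> * (y i)\<^sup>2)"
    by (subst sum.swap) (auto intro!: sum.cong simp: assms(2))
  have "A i j * y i * y j \<le> (\<bar>A i j\<bar> * (y i)\<^sup>2 + \<bar>A i j\<bar> * (y j)\<^sup>2) / 2" for i j
  proof -
    have "A i j * y i * y j \<le> \<bar>A i j\<bar> * (\<bar>y i\<bar> * \<bar>y j\<bar>)"
      by (metis abs_ge_self abs_mult mult.assoc)
    also have "\<dots> \<le> \<bar>A i j\<bar> * (((y i)\<^sup>2 + (y j)\<^sup>2) / 2)"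
      using sum_squares_bound[of "\<bar>y i\<bar>" "\<bar>y j\<bar>"] by (intro mult_left_mono) auto
    finally show ?thesis by (simp add: algebra_simps)
  qed
  then have "(\<Sum>i\<in>I. \<Sum>j\<in>I. A i j * y i * y j)
      \<le> (\<Sum>i\<in>I. \<Sum>j\<in>I. (\<bar>A i j\<bar> * (y i)\<^sup>2 + \<bar>A i j\<bar> * (y j)\<^sup>2) / 2)"
    by (intro sum_mono)
  also have "\<dots> = (\<Sum>i\<in>I. \<Sum>j\<in>I. \<bar>A i j\<bar> * (y i)\<^sup>2)"
    using ** by (simp add: sum_divide_distrib[symmetric] sum.distrib)
  finally show ?thesis using * by linarith
qed

text \<open>With \<open>z\<close> the transpose applied to \<open>y\<close>,
  \<open>|z|^2 = <y, A z>\<close> is at most the mean of \<open>|y|^2\<close> and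
  \<open>|A z|^2\<close>, hence of \<open>|y|^2\<close> and \<open>|z|^2\<close>; it remains to
  solve for \<open>|z|^2\<close>.\<close>

lemma contractive_transpose:
  assumes "contractive I A"
  shows "contractive I (\<lambda>i j. A j i)"
  unfolding contractive_def
proof
  fix y :: "int \<Rightarrow> real"
  define z where "z i = (\<Sum>j\<in>I. A j i * y j)" for i
  have am_gm: "a * b \<le> (a\<^sup>2 + b\<^sup>2) / 2" for a b :: real
    using sum_squares_bound[of a b] by simp
  have "(\<Sum>i\<in>I. (z i)\<^sup>2) = (\<Sum>i\<in>I. \<Sum>j\<in>I. y j * (A j i * z i))"
    by (simp add: power2_eq_square z_def sum_distrib_right sum_distrib_left mult_ac)
  also have "\<dots> = (\<Sum>j\<in>I. y j * (\<Sum>i\<in>I. A j i * z i))"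
    by (subst sum.swap) (simp add: sum_distrib_left)
  also have "\<dots> \<le> (\<Sum>j\<in>I. ((y j)\<^sup>2 + (\<Sum>i\<in>I. A j i * z i)\<^sup>2) / 2)"
    by (intro sum_mono am_gm)
  also have "\<dots> \<le> ((\<Sum>j\<in>I. (y j)\<^sup>2) + (\<Sum>i\<in>I. (z i)\<^sup>2)) / 2"
    using assms by (simp add: contractive_def sum.distrib sum_divide_distrib[symmetric])
  finally show "(\<Sum>i\<in>I. (\<Sum>j\<in>I. A j i * y j)\<^sup>2) \<le> (\<Sum>j\<in>I. (y j)\<^sup>2)"
    by (simp add: z_def)
qed

text \<open>Compression to a block: test vectors are extended by zero and the rows outside
  \<open>K\<close> are dropped.\<close>

lemma contractive_subset:
  assumes "contractive I A" "finite I" "K \<subseteq> I"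
  shows "contractive K A"
  unfolding contractive_def
proof
  fix y :: "int \<Rightarrow> real"
  define z where "z j = (if j \<in> K then y j else 0)" for j
  have z: "(\<Sum>j\<in>I. A i j * z j) = (\<Sum>j\<in>K. A i j * y j)" for i
    using assms by (intro sum.mono_neutral_cong_right) (auto simp: z_def)
  have "(\<Sum>i\<in>K. (\<Sum>j\<in>K. A i j * y j)\<^sup>2) \<le> (\<Sum>i\<in>I. (\<Sum>j\<in>I. A i j * z j)\<^sup>2)"
    unfolding z using assms by (intro sum_mono2) auto
  also have "\<dots> \<le> (\<Sum>j\<in>I. (z j)\<^sup>2)"
    using assms(1) unfolding contractive_def by blast
  also have "\<dots> = (\<Sum>j\<in>K. (y j)\<^sup>2)"
    using assms by (intro sum.mono_neutral_cong_right) (auto simp: z_def)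
  finally show "(\<Sum>i\<in>K. (\<Sum>j\<in>K. A i j * y j)\<^sup>2) \<le> (\<Sum>j\<in>K. (y j)\<^sup>2)" .
qed

text \<open>Column \<open>j\<close> of each power is the image of a unit vector under contractions,
  so its Euclidean norm is at most 1.\<close>

lemma contractive_mpow_le_1:
  assumes "contractive I A" "finite I" "i \<in> I" "j \<in> I"
  shows "\<bar>mpow I A k i j\<bar> \<le> 1"
proof -
  have "(\<Sum>i\<in>I. (mpow I A k i j)\<^sup>2) \<le> 1"
  proof (induction k)
    case 0
    then show ?case using assms by (simp add: mid_def if_distrib[of "\<lambda>x. x\<^sup>2"] cong: if_cong)
  next
    case (Suc k)
    have "(\<Sum>i\<in>I. (mpow I A (Suc k) i j)\<^sup>2) \<le> (\<Sum>i\<in>I. (mpow I A k i j)\<^sup>2)"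
      using assms(1) by (simp add: contractive_def mmul_def)
    then show ?case using Suc by linarith
  qed
  moreover have "(mpow I A k i j)\<^sup>2 \<le> (\<Sum>i\<in>I. (mpow I A k i j)\<^sup>2)"
    using assms by (intro member_le_sum) auto
  ultimately have "(mpow I A k i j)\<^sup>2 \<le> 1" by linarith
  then show ?thesis by (simp add: abs_square_le_1)
qed

text \<open>The Taylor coefficients of \<open>(1 - x)\<^sup>-\<^sup>1\<^sup>/\<^sup>2\<close>.\<close>

definition inv_sqrt_coeff :: "nat \<Rightarrow> real" where
  "inv_sqrt_coeff k = pochhammer (1/2) k / fact k"

lemma inv_sqrt_coeff_0 [simp]: "inv_sqrt_coeff 0 = 1"
  by (simp add: inv_sqrt_coeff_def)

lemma inv_sqrt_coeff_Suc: "inv_sqrt_coeff (Suc k) = inv_sqrt_coeff k * ((2 * real k + 1) / (2 * real k + 2))"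
  by (simp add: inv_sqrt_coeff_def pochhammer_Suc field_simps)

lemma inv_sqrt_coeff_pos: "inv_sqrt_coeff k > 0"
  by (induction k) (auto simp: inv_sqrt_coeff_Suc)

lemma inv_sqrt_coeff_Suc_le: "inv_sqrt_coeff (Suc k) \<le> inv_sqrt_coeff k"
  unfolding inv_sqrt_coeff_Suc using inv_sqrt_coeff_pos[of k] by (intro mult_left_le) auto

lemma inv_sqrt_coeff_le_1: "inv_sqrt_coeff k \<le> 1"
  by (induction k) (auto intro: order_trans[OF inv_sqrt_coeff_Suc_le])

text \<open>The square of the series is the geometric series: Vandermonde's identity with the
  exponents \<open>-1/2\<close> and \<open>-1/2\<close>, whose sum is \<open>-1\<close>.\<close>

lemma inv_sqrt_coeff_convolution: "(\<Sum>i\<le>n. inv_sqrt_coeff i * inv_sqrt_coeff (n - i)) = 1"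
proof -
  have g: "(-1/2 gchoose k) = (-1) ^ k * inv_sqrt_coeff k" for k
    by (simp add: gbinomial_pochhammer inv_sqrt_coeff_def)
  have "(\<Sum>i\<le>n. inv_sqrt_coeff i * inv_sqrt_coeff (n - i)) = (\<Sum>i\<le>n. (-1) ^ n * ((-1/2 gchoose i) * (-1/2 gchoose (n - i))))"
    unfolding g by (intro sum.cong) (auto simp: power_add[symmetric] mult.assoc[symmetric])
  also have "\<dots> = (-1) ^ n * ((-1/2 + -1/2 :: real) gchoose n)"
    unfolding gbinomial_Vandermonde[symmetric] by (simp add: sum_distrib_left atMost_atLeast0)
  also have "\<dots> = 1"
    by (simp add: gbinomial_pochhammer pochhammer_fact[symmetric] power_mult_distrib[symmetric] mult.assoc[symmetric])
  finally show ?thesis .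
qed

section \<open>Square roots of \<open>1 - X\<close> by convergent power series\<close>

locale small_symmetric_matrix =
  fixes I :: "int set" and X :: "int \<Rightarrow> int \<Rightarrow> real" and \<theta> :: real
  assumes finite_I: "finite I"
    and X_sym: "\<And>i j. i \<in> I \<Longrightarrow> j \<in> I \<Longrightarrow> X i j = X j i"
    and X_row: "\<And>i. i \<in> I \<Longrightarrow> (\<Sum>j\<in>I. \<bar>X i j\<bar>) \<le> \<theta>"
    and theta: "0 \<le> \<theta>" "\<theta> < 1"
begin

text \<open>The matrix \<open>(1 - X)^(-1/2)\<close>.\<close>

definition R :: "int \<Rightarrow> int \<Rightarrow> real" where
  "R i j = (\<Sum>k. inv_sqrt_coeff k * mpow I X k i j)"

text \<open>The matrix \<open>(1 - X)^(1/2)\<close>, written as \<open>R (1 - X)\<close> so that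
  everything is expressed by a single series.\<close>

definition P :: "int \<Rightarrow> int \<Rightarrow> real" where
  "P i j = R i j - mmul I R X i j"

lemma mpow_le: "i \<in> I \<Longrightarrow> j \<in> I \<Longrightarrow> \<bar>mpow I X k i j\<bar> \<le> \<theta> ^ k"
  using mpow_row_sum_le[OF finite_I X_row theta(1), of _ i k]
    member_le_sum[of j I "\<lambda>j. \<bar>mpow I X k i j\<bar>"] finite_I by fastforce

lemma summable_mpow_abs:
  assumes "i \<in> I" "j \<in> I" "\<And>k. \<bar>c k\<bar> \<le> (1::real)"
  shows "summable (\<lambda>k. \<bar>c k * mpow I X k i j\<bar>)"
proof (rule summable_comparison_test')
  show "summable (\<lambda>k. \<theta> ^ k)" using theta by (simp add: summable_geometric)
  show "norm \<bar>c k * mpow I X k i j\<bar> \<le> \<theta> ^ k" for k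
    using mult_mono[OF assms(3)[of k] mpow_le[OF assms(1,2), of k]] by (simp add: abs_mult)
qed

lemma summable_mpow:
  assumes "i \<in> I" "j \<in> I" "\<And>k. \<bar>c k\<bar> \<le> (1::real)"
  shows "summable (\<lambda>k. c k * mpow I X k i j)"
  by (rule summable_rabs_cancel[OF summable_mpow_abs]) (use assms in auto)

lemma abs_inv_sqrt_coeff_le_1: "\<bar>inv_sqrt_coeff k\<bar> \<le> 1"
  using inv_sqrt_coeff_pos[of k] inv_sqrt_coeff_le_1[of k] by simp

lemma R_sums: "i \<in> I \<Longrightarrow> j \<in> I \<Longrightarrow> (\<lambda>k. inv_sqrt_coeff k * mpow I X k i j) sums R i j"
  unfolding R_def by (intro summable_sums summable_mpow abs_inv_sqrt_coeff_le_1)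

lemma R_sym: "i \<in> I \<Longrightarrow> j \<in> I \<Longrightarrow> R i j = R j i"
  unfolding R_def using mpow_symmetric[OF finite_I X_sym] by presburger

lemma RX_sums:
  assumes "i \<in> I" "j \<in> I"
  shows "(\<lambda>k. inv_sqrt_coeff k * mpow I X (Suc k) i j) sums mmul I R X i j"
proof -
  have "(\<lambda>k. \<Sum>l\<in>I. inv_sqrt_coeff k * mpow I X k i l * X l j) sums (\<Sum>l\<in>I. R i l * X l j)"
    using assms by (intro sums_sum sums_mult2 R_sums)
  then show ?thesis
    using mpow_Suc_right[OF finite_I assms] by (simp add: mmul_def sum_distrib_left mult.assoc)
qed

lemma XR_eq_RX:
  assumes "i \<in> I" "j \<in> I"
  shows "mmul I X R i j = mmul I R X i j"
proof -
  have "(\<lambda>k. \<Sum>l\<in>I. X i l * (inv_sqrt_coeff k * mpow I X k l j)) sums (\<Sum>l\<in>I. X i l * R l j)"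
    using assms by (intro sums_sum sums_mult R_sums)
  moreover have "(\<lambda>k. \<Sum>l\<in>I. X i l * (inv_sqrt_coeff k * mpow I X k l j)) = (\<lambda>k. inv_sqrt_coeff k * mpow I X (Suc k) i j)"
    by (simp add: mmul_def sum_distrib_left mult_ac)
  ultimately have "(\<lambda>k. inv_sqrt_coeff k * mpow I X (Suc k) i j) sums mmul I X R i j"
    by (simp add: mmul_def)
  then show ?thesis using RX_sums[OF assms] sums_unique2 by blast
qed

lemma P_sym:
  assumes "i \<in> I" "j \<in> I"
  shows "P i j = P j i"
proof -
  have "mmul I R X i j = mmul I X R j i"
    unfolding mmul_def using assms by (intro sum.cong) (auto simp: R_sym X_sym)
  then show ?thesis using assms by (simp add: P_def R_sym XR_eq_RX)
qed

text \<open>Cauchy products, taken entry by entry: by the convolution identity every coefficient of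
  \<open>R^2\<close> is 1, so \<open>R^2\<close> is the Neumann series of
  \<open>(1 - X)^(-1)\<close>.\<close>

lemma RR_sums:
  assumes "i \<in> I" "j \<in> I"
  shows "(\<lambda>n. mpow I X n i j) sums mmul I R R i j"
proof -
  have "(\<lambda>n. \<Sum>m\<le>n. (inv_sqrt_coeff m * mpow I X m i l) * (inv_sqrt_coeff (n - m) * mpow I X (n - m) l j)) sums (R i l * R l j)"
    if "l \<in> I" for l
    unfolding R_def using assms that summable_mpow_abs[OF _ _ abs_inv_sqrt_coeff_le_1]
    by (intro Cauchy_product_sums) auto
  then have "(\<lambda>n. \<Sum>l\<in>I. \<Sum>m\<le>n. (inv_sqrt_coeff m * mpow I X m i l) * (inv_sqrt_coeff (n - m) * mpow I X (n - m) l j))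
      sums mmul I R R i j"
    unfolding mmul_def by (intro sums_sum)
  moreover have "(\<Sum>l\<in>I. \<Sum>m\<le>n. (inv_sqrt_coeff m * mpow I X m i l) * (inv_sqrt_coeff (n - m) * mpow I X (n - m) l j))
      = mpow I X n i j" for n
  proof -
    have "(\<Sum>l\<in>I. \<Sum>m\<le>n. (inv_sqrt_coeff m * mpow I X m i l) * (inv_sqrt_coeff (n - m) * mpow I X (n - m) l j))
        = (\<Sum>m\<le>n. inv_sqrt_coeff m * inv_sqrt_coeff (n - m) * mmul I (mpow I X m) (mpow I X (n - m)) i j)"
      by (subst sum.swap) (simp add: mmul_def sum_distrib_left mult_ac)
    also have "\<dots> = (\<Sum>m\<le>n. inv_sqrt_coeff m * inv_sqrt_coeff (n - m) * mpow I X n i j)"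
      by (intro sum.cong) (auto simp flip: mpow_add[OF finite_I assms(1)])
    finally show ?thesis by (simp add: sum_distrib_right[symmetric] inv_sqrt_coeff_convolution)
  qed
  ultimately show ?thesis by simp
qed

text \<open>\<open>P R = R^2 - X R^2\<close> is the Neumann series minus its own shift, which leaves
  the zeroth term.\<close>

lemma PR_eq_mid:
  assumes "i \<in> I" "j \<in> I"
  shows "mmul I P R i j = mid i j"
proof -
  have "mmul I P R i j = mmul I (\<lambda>i j. R i j - mmul I X R i j) R i j"
    using assms by (intro mmul_cong) (auto simp: P_def XR_eq_RX)
  also have "\<dots> = mmul I R R i j - mmul I (mmul I X R) R i j"
    by (simp add: mmul_def[of I "\<lambda>i j. R i j - mmul I X R i j"] left_diff_distrib sum_subtractf mmul_def[of I R R]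
          mmul_def[of I "mmul I X R"])
  also have "mmul I (mmul I X R) R i j = mmul I X (mmul I R R) i j"
    by (rule mmul_assoc)
  finally have eq: "mmul I P R i j = mmul I R R i j - mmul I X (mmul I R R) i j" .
  have "(\<lambda>n. \<Sum>l\<in>I. X i l * mpow I X n l j) sums (\<Sum>l\<in>I. X i l * mmul I R R l j)"
    using assms by (intro sums_sum sums_mult RR_sums)
  then have "(\<lambda>n. mpow I X (Suc n) i j) sums mmul I X (mmul I R R) i j"
    by (simp add: mmul_def)
  then have "(\<lambda>n. mpow I X n i j) sums (mmul I X (mmul I R R) i j + mpow I X 0 i j)"
    by (subst (asm) sums_Suc_iff) (simp del: mpow.simps(2))
  then show ?thesis
    using eq sums_unique2[OF RR_sums[OF assms]] by simp
qed

text \<open>The series of \<open>1 - (1 - x)^(1/2)\<close> has no constant term, and its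
  coefficients are the differences \<open>d k\<close>, which are nonnegative with partial sums at
  most 1. Every power of \<open>X\<close> that occurs has row sums at most \<open>\<theta>\<close>.
  By the Schur test this makes \<open>P\<close> positive definite with lower bound
  \<open>1 - \<theta>\<close>.\<close>

lemma mid_minus_P_row:
  assumes "i \<in> I"
  shows "(\<Sum>j\<in>I. \<bar>mid i j - P i j\<bar>) \<le> \<theta>"
proof -
  define d where "d k = inv_sqrt_coeff k - inv_sqrt_coeff (Suc k)" for k
  have d0: "d k \<ge> 0" for k using inv_sqrt_coeff_Suc_le by (simp add: d_def)
  have s: "(\<lambda>k. d k * mpow I X (Suc k) i j) sums (mid i j - P i j)" if "j \<in> I" for j
  proof -
    have "(\<lambda>k. inv_sqrt_coeff (Suc k) * mpow I X (Suc k) i j) sums (R i j - mid i j)"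
      using R_sums[OF assms that] by (subst sums_Suc_iff) simp
    from sums_diff[OF RX_sums[OF assms that] this] show ?thesis
      by (simp add: d_def P_def left_diff_distrib algebra_simps)
  qed
  have dsum: "(\<Sum>k<N. d k) \<le> 1" for N
  proof -
    have "(\<Sum>k<N. d k) = inv_sqrt_coeff 0 - inv_sqrt_coeff N" unfolding d_def by (rule sum_lessThan_telescope')
    then show ?thesis using inv_sqrt_coeff_pos[of N] by simp
  qed
  have "(\<lambda>N. \<Sum>j\<in>I. \<bar>\<Sum>k<N. d k * mpow I X (Suc k) i j\<bar>) \<longlonglongrightarrow> (\<Sum>j\<in>I. \<bar>mid i j - P i j\<bar>)"
    using s unfolding sums_def by (intro tendsto_sum tendsto_rabs) auto
  moreover have "(\<Sum>j\<in>I. \<bar>\<Sum>k<N. d k * mpow I X (Suc k) i j\<bar>) \<le> \<theta>" for N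
  proof -
    have "(\<Sum>j\<in>I. \<bar>\<Sum>k<N. d k * mpow I X (Suc k) i j\<bar>)
        \<le> (\<Sum>j\<in>I. \<Sum>k<N. d k * \<bar>mpow I X (Suc k) i j\<bar>)"
    proof (rule sum_mono)
      fix j
      have "\<bar>\<Sum>k<N. d k * mpow I X (Suc k) i j\<bar> \<le> (\<Sum>k<N. \<bar>d k * mpow I X (Suc k) i j\<bar>)"
        by (rule sum_abs)
      then show "\<bar>\<Sum>k<N. d k * mpow I X (Suc k) i j\<bar> \<le> (\<Sum>k<N. d k * \<bar>mpow I X (Suc k) i j\<bar>)"
        using d0 by (simp add: abs_mult)
    qed
    also have "\<dots> = (\<Sum>k<N. d k * (\<Sum>j\<in>I. \<bar>mpow I X (Suc k) i j\<bar>))"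
      by (subst sum.swap) (simp add: sum_distrib_left)
    also have "\<dots> \<le> (\<Sum>k<N. d k * \<theta>)"
    proof (intro sum_mono mult_left_mono d0)
      fix k
      have "(\<Sum>j\<in>I. \<bar>mpow I X (Suc k) i j\<bar>) \<le> \<theta> ^ Suc k"
        using assms by (intro mpow_row_sum_le finite_I X_row theta)
      also have "\<dots> \<le> \<theta> ^ 1" using theta by (intro power_decreasing) auto
      finally show "(\<Sum>j\<in>I. \<bar>mpow I X (Suc k) i j\<bar>) \<le> \<theta>" by simp
    qed
    also have "\<dots> = (\<Sum>k<N. d k) * \<theta>" by (simp add: sum_distrib_right)
    also have "\<dots> \<le> 1 * \<theta>" by (intro mult_right_mono dsum theta)
    finally show ?thesis by simp
  qed
  ultimately show ?thesis by (intro LIMSEQ_le_const2) auto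
qed

end

section \<open>Spin configurations and Majorana operators\<close>

lemma finite_box [simp]: "finite (box L)"
  by (simp add: box_def)

lemma zval_mult_self [simp]: "zval b * zval b = 1" "zval b * (zval b * x) = x"
  by (auto simp: zval_def)

lemma zval_Not [simp]: "zval (\<not> b) = - zval b"
  by (auto simp: zval_def)

lemma finite_configs [simp]: "finite (configs L)"
proof (rule finite_imageD)
  show "finite ((\<lambda>s. {i. s i}) ` configs L)"
    by (rule finite_subset[of _ "Pow (box L)"]) (auto simp: configs_def)
  show "inj_on (\<lambda>s. {i. s i}) (configs L)"
    by (auto simp: inj_on_def set_eq_iff)
qed

lemma flip_flip [simp]: "flip i (flip i s) = s"
  by (auto simp: flip_def)

lemma flip_commute: "flip i (flip j s) = flip j (flip i s)"
  by (auto simp: flip_def fun_eq_iff)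

lemma flip_apply: "flip i s j = (if j = i then \<not> s j else s j)"
  by (simp add: flip_def)

lemma flip_in_configs_iff [simp]: "i \<in> box L \<Longrightarrow> flip i s \<in> configs L \<longleftrightarrow> s \<in> configs L"
  by (auto simp: configs_def flip_apply)

lemma sum_configs_flip:
  "i \<in> box L \<Longrightarrow> (\<Sum>s\<in>configs L. f (flip i s)) = (\<Sum>s\<in>configs L. f s)"
  by (rule sum.reindex_bij_witness[of _ "flip i" "flip i"]) auto

lemma bond_in_box: "i \<in> {- int L ..< int L} \<Longrightarrow> i \<in> box L \<and> i + 1 \<in> box L"
  by (auto simp: box_def)

lemma sum_configs_flip_bond:
  assumes "i \<in> {- int L ..< int L}"
  shows "(\<Sum>s\<in>configs L. f (flip i (flip (i + 1) s))) = (\<Sum>s\<in>configs L. f s)"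
  using sum_configs_flip[of "i+1" L "\<lambda>s. f (flip i s)"] sum_configs_flip[of i L f] bond_in_box[OF assms]
  by simp

section \<open>Jordan-Wigner strings and real Majorana operators\<close>

definition jw_sign :: "nat \<Rightarrow> int \<Rightarrow> (int \<Rightarrow> bool) \<Rightarrow> real" where
  "jw_sign L k s = (\<Prod>i\<in>{- int L ..< k}. zval (s i))"

definition maj_a :: "nat \<Rightarrow> int \<Rightarrow> ((int \<Rightarrow> bool) \<Rightarrow> real) \<Rightarrow> (int \<Rightarrow> bool) \<Rightarrow> real" where
  "maj_a L k v s = jw_sign L k s * v (flip k s)"

text \<open>This operator squares to -1, that is, it is a Hermitian Majorana operator up to a factor
  of modulus one. The choice keeps all coefficients real.\<close>

definition maj_b :: "nat \<Rightarrow> int \<Rightarrow> ((int \<Rightarrow> bool) \<Rightarrow> real) \<Rightarrow> (int \<Rightarrow> bool) \<Rightarrow> real" where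
  "maj_b L k v s = zval (s k) * maj_a L k v s"

lemma jw_sign_mult_self [simp]: "jw_sign L k s * jw_sign L k s = 1" "jw_sign L k s * (jw_sign L k s * x) = x"
  by (auto simp: jw_sign_def prod.distrib[symmetric] mult.assoc[symmetric])

lemma jw_sign_nonzero [simp]: "jw_sign L k s \<noteq> 0"
  by (auto simp: jw_sign_def zval_def)

lemma jw_sign_Suc: "k \<ge> - int L \<Longrightarrow> jw_sign L (k + 1) s = jw_sign L k s * zval (s k)"
proof -
  assume "k \<ge> - int L"
  then have "{- int L ..< k + 1} = insert k {- int L ..< k}" by auto
  then show ?thesis by (simp add: jw_sign_def mult.commute)
qed

lemma jw_sign_flip: "jw_sign L k (flip i s) = (if - int L \<le> i \<and> i < k then - jw_sign L k s else jw_sign L k s)"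
proof (cases "- int L \<le> i \<and> i < k")
  case True
  then have "(\<Prod>j\<in>{- int L ..< k}. zval (flip i s j))
      = zval (flip i s i) * (\<Prod>j\<in>{- int L ..< k} - {i}. zval (flip i s j))"
    by (intro prod.remove) auto
  also have "\<dots> = - (zval (s i) * (\<Prod>j\<in>{- int L ..< k} - {i}. zval (s j)))"
    by (simp add: flip_apply)
  also have "zval (s i) * (\<Prod>j\<in>{- int L ..< k} - {i}. zval (s j)) = (\<Prod>j\<in>{- int L ..< k}. zval (s j))"
    using True by (intro prod.remove[symmetric]) auto
  finally show ?thesis using True by (simp add: jw_sign_def)
next
  case False
  then show ?thesis by (auto simp: jw_sign_def flip_apply intro!: prod.cong)
qed

text \<open>A Majorana operator anticommutes with one field term and at most one bond term and
  commutes with the others, so moving it through the Hamiltonian reverses single signs in the two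
  sums.\<close>

lemma sum_sign_change:
  fixes g :: "int \<Rightarrow> real"
  assumes "finite S"
  shows "(\<Sum>i\<in>S. (if i = k then - 1 else 1) * g i) = (\<Sum>i\<in>S. g i) - 2 * (if k \<in> S then g k else 0)"
proof -
  have "(\<Sum>i\<in>S. (if i = k then - 1 else 1) * g i) = (\<Sum>i\<in>S. g i - (if i = k then 2 * g i else 0))"
    by (intro sum.cong) auto
  then show ?thesis using assms by (simp add: sum_subtractf sum.delta')
qed

text \<open>The terms that anticommute with the operator at \<open>k\<close> are the field at
  \<open>k\<close> and the bond from \<open>k - 1\<close> to \<open>k\<close>; the latter turns it
  into \<open>maj_b\<close> at \<open>k - 1\<close>. At the left end of the box this bond is
  missing.\<close>

lemma ham_maj_a:
  assumes "k \<in> box L"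
  shows "ham J h L (maj_a L k v) s
    = maj_a L k (ham J h L v) s - 2 * (h * maj_b L k v s - (if k > - int L then J * maj_b L (k - 1) v s else 0))"
proof -
  let ?B = "{- int L ..< int L}"
  let ?g = "\<lambda>i. jw_sign L k s * v (flip i (flip (i + 1) (flip k s)))"
  \<comment> \<open>A bond flips two neighbouring sites. Both or neither lie in the string to the
    left of \<open>k\<close>, except when \<open>i = k - 1\<close>.\<close>
  have "maj_a L k v (flip i (flip (i + 1) s)) = (if i = k - 1 then - 1 else 1) * ?g i" if "i \<in> ?B" for i
    using that by (auto simp: maj_a_def jw_sign_flip flip_commute)
  then have bond: "(\<Sum>i\<in>?B. maj_a L k v (flip i (flip (i + 1) s)))
      = (\<Sum>i\<in>?B. ?g i) - 2 * (if k - 1 \<in> ?B then ?g (k - 1) else 0)"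
    by (intro trans[OF sum.cong[OF refl] sum_sign_change]) simp_all
  have g: "(if k - 1 \<in> ?B then ?g (k - 1) else 0) = (if k > - int L then maj_b L (k - 1) v s else 0)"
    using assms jw_sign_Suc[of L "k - 1" s] by (auto simp: box_def maj_b_def maj_a_def)
  have "(\<Sum>i\<in>box L. zval (flip k s i)) = (\<Sum>i\<in>box L. (if i = k then - 1 else 1) * zval (s i))"
    by (intro sum.cong) (auto simp: flip_apply)
  then have field: "(\<Sum>i\<in>box L. zval (flip k s i)) = (\<Sum>i\<in>box L. zval (s i)) - 2 * zval (s k)"
    using assms by (simp add: sum_sign_change)
  show ?thesis
    unfolding ham_def bond g maj_a_def[of L k "\<lambda>s. - J * _ s - _ s"] field
    by (simp add: maj_a_def maj_b_def sum_distrib_left algebra_simps)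
qed

lemma ham_maj_b:
  assumes "k \<in> box L"
  shows "ham J h L (maj_b L k v) s
    = maj_b L k (ham J h L v) s - 2 * (h * maj_a L k v s - (if k < int L then J * maj_a L (k + 1) v s else 0))"
proof -
  let ?B = "{- int L ..< int L}"
  let ?g = "\<lambda>i. zval (s k) * jw_sign L k s * v (flip i (flip (i + 1) (flip k s)))"
  \<comment> \<open>The extra factor \<open>zval (s k)\<close> changes sign for
    \<open>i = k - 1\<close> and \<open>i = k\<close>, which moves the exceptional bond from
    \<open>k - 1\<close> to \<open>k\<close>.\<close>
  have "maj_b L k v (flip i (flip (i + 1) s)) = (if i = k then - 1 else 1) * ?g i" if "i \<in> ?B" for i
    using that assms by (auto simp: maj_b_def maj_a_def jw_sign_flip flip_commute flip_apply box_def)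
  then have bond: "(\<Sum>i\<in>?B. maj_b L k v (flip i (flip (i + 1) s)))
      = (\<Sum>i\<in>?B. ?g i) - 2 * (if k \<in> ?B then ?g k else 0)"
    by (intro trans[OF sum.cong[OF refl] sum_sign_change]) simp_all
  have g: "(if k \<in> ?B then ?g k else 0) = (if k < int L then maj_a L (k + 1) v s else 0)"
    using assms jw_sign_Suc[of L k s] by (auto simp: box_def maj_a_def flip_commute[of "k + 1" k])
  have "(\<Sum>i\<in>box L. zval (flip k s i)) = (\<Sum>i\<in>box L. (if i = k then - 1 else 1) * zval (s i))"
    by (intro sum.cong) (auto simp: flip_apply)
  then have field: "(\<Sum>i\<in>box L. zval (flip k s i)) = (\<Sum>i\<in>box L. zval (s i)) - 2 * zval (s k)"
    using assms by (simp add: sum_sign_change)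
  show ?thesis
    unfolding ham_def bond g maj_b_def[of L k "\<lambda>s. - J * _ s - _ s"] maj_a_def[of L k "\<lambda>s. - J * _ s - _ s"] field
    by (simp add: maj_a_def maj_b_def sum_distrib_left algebra_simps)
qed

text \<open>For distinct sites, flipping both \<open>i\<close> and \<open>j\<close> permutes the
  configurations and reverses the sign of the summand; this is the anticommutation relation.\<close>

lemma maj_b_orthonormal:
  assumes "i \<in> box L" "j \<in> box L"
  shows "(\<Sum>s\<in>configs L. maj_b L i w s * maj_b L j w s) = (if i = j then \<Sum>s\<in>configs L. (w s)\<^sup>2 else 0)"
proof (cases "i = j")
  case True
  have "(\<Sum>s\<in>configs L. maj_b L i w s * maj_b L i w s) = (\<Sum>s\<in>configs L. (w (flip i s))\<^sup>2)"
    by (simp add: maj_b_def maj_a_def power2_eq_square mult_ac)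
  then show ?thesis using True sum_configs_flip[OF assms(1), of "\<lambda>s. (w s)\<^sup>2"] by simp
next
  case False
  have "(\<Sum>s\<in>configs L. maj_b L i w s * maj_b L j w s)
      = (\<Sum>s\<in>configs L. maj_b L i w (flip i (flip j s)) * maj_b L j w (flip i (flip j s)))"
    using sum_configs_flip[OF assms(1), of "\<lambda>s. maj_b L i w s * maj_b L j w s"]
      sum_configs_flip[OF assms(2), of "\<lambda>s. maj_b L i w (flip i s) * maj_b L j w (flip i s)"] by simp
  also have "\<dots> = (\<Sum>s\<in>configs L. - (maj_b L i w s * maj_b L j w s))"
    using False assms
    by (intro sum.cong) (auto simp: maj_b_def maj_a_def jw_sign_flip flip_apply box_def flip_commute[of i j])
  finally show ?thesis using False by (simp add: sum_negf)
qed

text \<open>Makes the magnetisation at \<open>k\<close> a diagonal entry of the Majorana two-point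
  function.\<close>

lemma sum_maj_b_maj_a:
  assumes "k \<in> box L"
  shows "(\<Sum>s\<in>configs L. maj_b L k w s * maj_a L k w s) = - (\<Sum>s\<in>configs L. zval (s k) * (w s)\<^sup>2)"
proof -
  have "(\<Sum>s\<in>configs L. maj_b L k w s * maj_a L k w s) = (\<Sum>s\<in>configs L. - (zval (flip k s k) * (w (flip k s))\<^sup>2))"
    by (intro sum.cong) (auto simp: maj_b_def maj_a_def power2_eq_square flip_apply mult_ac)
  also have "\<dots> = (\<Sum>s\<in>configs L. - (zval (s k) * (w s)\<^sup>2))"
    by (rule sum_configs_flip[OF assms])
  finally show ?thesis by (simp add: sum_negf)
qed

section \<open>The Hamiltonian as a symmetric operator, and its lowest eigenvalue\<close>

lemma ham_linear:
  "ham J h L (\<lambda>s. f s + c * g s) s = ham J h L f s + c * ham J h L g s"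
  by (simp add: ham_def sum.distrib sum_distrib_left algebra_simps)

lemma ham_scale: "ham J h L (\<lambda>s. c * g s) s = c * ham J h L g s"
  by (simp add: ham_def sum_distrib_left algebra_simps)

lemma ham_sum:
  "ham J h L (\<lambda>s. \<Sum>i\<in>S. c i * g i s) s = (\<Sum>i\<in>S. c i * ham J h L (g i) s)"
proof (induction S rule: infinite_finite_induct)
  case (insert x F)
  then show ?case using ham_linear[of J h L "\<lambda>s. \<Sum>i\<in>F. c i * g i s" "c x" "g x" s]
    by (simp add: add.commute)
qed (auto simp: ham_def)

lemma ham_cong:
  assumes "\<And>s. s \<in> configs L \<Longrightarrow> f s = g s" "s \<in> configs L"
  shows "ham J h L f s = ham J h L g s"
proof -
  have "f (flip i (flip (i + 1) s)) = g (flip i (flip (i + 1) s))" if "i \<in> {- int L ..< int L}" for i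
    using bond_in_box[OF that] assms by simp
  then show ?thesis using assms by (simp add: ham_def)
qed

lemma ham_symmetric:
  "(\<Sum>s\<in>configs L. f s * ham J h L g s) = (\<Sum>s\<in>configs L. g s * ham J h L f s)"
proof -
  have "(\<Sum>s\<in>configs L. f s * g (flip i (flip (i + 1) s))) = (\<Sum>s\<in>configs L. g s * f (flip i (flip (i + 1) s)))"
    if "i \<in> {- int L ..< int L}" for i
    using sum_configs_flip_bond[OF that, of "\<lambda>s. f s * g (flip i (flip (i + 1) s))"]
    by (simp add: flip_commute[of "i + 1" i] mult.commute)
  then have "(\<Sum>i\<in>{- int L ..< int L}. \<Sum>s\<in>configs L. f s * g (flip i (flip (i + 1) s)))
      = (\<Sum>i\<in>{- int L ..< int L}. \<Sum>s\<in>configs L. g s * f (flip i (flip (i + 1) s)))"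
    by (rule sum.cong[OF refl])
  then have "(\<Sum>s\<in>configs L. f s * (\<Sum>i\<in>{- int L ..< int L}. g (flip i (flip (i + 1) s))))
      = (\<Sum>s\<in>configs L. g s * (\<Sum>i\<in>{- int L ..< int L}. f (flip i (flip (i + 1) s))))"
    unfolding sum_distrib_left sum.swap[of _ "{- int L ..< int L}" "configs L"] .
  moreover have "(\<Sum>s\<in>configs L. u s * ham J h L w s) =
      - J * (\<Sum>s\<in>configs L. u s * (\<Sum>i\<in>{- int L ..< int L}. w (flip i (flip (i + 1) s))))
      - h * (\<Sum>s\<in>configs L. (\<Sum>i\<in>box L. zval (s i)) * (u s * w s))" for u w
    by (simp add: ham_def sum_distrib_left sum_subtractf[symmetric] algebra_simps)
  ultimately show ?thesis by (simp add: mult.commute)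
qed

text \<open>Vectors are functions on a whole type, so their values off \<open>S\<close> are pinned
  to zero. The unit vectors then form a closed subset of a product of compact intervals.\<close>

lemma compact_unit_functions:
  fixes S :: "'a set"
  assumes "finite S"
  shows "compact {v :: 'a \<Rightarrow> real. (\<forall>s. s \<notin> S \<longrightarrow> v s = 0) \<and> (\<Sum>s\<in>S. (v s)\<^sup>2) = 1}"
proof -
  define K where "K = PiE UNIV (\<lambda>s. if s \<in> S then {-1..1::real} else {0})"
  have "compact K"
    unfolding K_def compactin_euclidean_iff[symmetric] euclidean_product_topology[symmetric]
    by (auto simp: compactin_PiE simp del: compactin_euclidean_iff simp add: compactin_euclidean_iff)
  moreover have "closed {v :: 'a \<Rightarrow> real. (\<Sum>s\<in>S. (v s)\<^sup>2) = 1}"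
    by (intro closed_Collect_eq continuous_intros continuous_on_product_coordinates)
  ultimately have "compact (K \<inter> {v. (\<Sum>s\<in>S. (v s)\<^sup>2) = 1})"
    by (rule compact_Int_closed)
  also have "K \<inter> {v. (\<Sum>s\<in>S. (v s)\<^sup>2) = 1} = {v. (\<forall>s. s \<notin> S \<longrightarrow> v s = 0) \<and> (\<Sum>s\<in>S. (v s)\<^sup>2) = 1}"
  proof -
    have "\<bar>v s\<bar> \<le> 1" if "(\<Sum>s\<in>S. (v s)\<^sup>2) = 1" "s \<in> S" for v :: "'a \<Rightarrow> real" and s
    proof -
      have "(v s)\<^sup>2 \<le> (\<Sum>s\<in>S. (v s)\<^sup>2)" using assms that by (intro member_le_sum) auto
      then show ?thesis using that by (simp add: abs_square_le_1)
    qed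
    then show ?thesis by (fastforce simp: K_def PiE_iff abs_le_iff split: if_splits)
  qed
  finally show ?thesis .
qed

text \<open>The quadratic form attains its minimum on the unit sphere. Varying the minimiser along
  each basis vector gives the eigenvalue equation.\<close>

lemma ham_lowest_eigenvector:
  "\<exists>E v. (\<Sum>s\<in>configs L. (v s)\<^sup>2) = 1 \<and> (\<forall>s\<in>configs L. ham J h L v s = E * v s) \<and>
     (\<forall>f. E * (\<Sum>s\<in>configs L. (f s)\<^sup>2) \<le> (\<Sum>s\<in>configs L. f s * ham J h L f s))"
proof -
  define U where "U = {v :: (int \<Rightarrow> bool) \<Rightarrow> real. (\<forall>s. s \<notin> configs L \<longrightarrow> v s = 0) \<and> (\<Sum>s\<in>configs L. (v s)\<^sup>2) = 1}"
  define q where "q f = (\<Sum>s\<in>configs L. f s * ham J h L f s)" for f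
  have "compact U" unfolding U_def by (intro compact_unit_functions) simp
  moreover have "(\<lambda>s. if s = (\<lambda>_. False) then 1 else 0) \<in> U"
  proof -
    have "(\<lambda>_. False) \<in> configs L" by (simp add: configs_def)
    then show ?thesis
      by (auto simp: U_def if_distrib[of "\<lambda>x. x\<^sup>2"] sum.delta cong: if_cong)
  qed
  moreover have "continuous_on U q"
    unfolding q_def ham_def
    by (rule continuous_on_subset[OF _ subset_UNIV])
      (intro continuous_intros continuous_on_product_coordinates)
  ultimately obtain v where v: "v \<in> U" "\<And>f. f \<in> U \<Longrightarrow> q v \<le> q f"
    using continuous_attains_inf[of U q] by blast
  have v1: "(\<Sum>s\<in>configs L. (v s)\<^sup>2) = 1" using v by (simp add: U_def)
  have low: "q v * (\<Sum>s\<in>configs L. (f s)\<^sup>2) \<le> q f" for f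
  proof (cases "(\<Sum>s\<in>configs L. (f s)\<^sup>2) = 0")
    case True
    then have "\<And>s. s \<in> configs L \<Longrightarrow> f s = 0" by (simp add: sum_nonneg_eq_0_iff)
    then have "q f = 0" by (simp add: q_def)
    then show ?thesis using True by simp
  next
    case False
    define N where "N = (\<Sum>s\<in>configs L. (f s)\<^sup>2)"
    have N: "N > 0" using False by (simp add: N_def sum_nonneg order_neq_le_trans)
    define g where "g s = (if s \<in> configs L then f s / sqrt N else 0)" for s
    have "g \<in> U"
      using N by (simp add: U_def g_def power_divide sum_divide_distrib[symmetric] N_def[symmetric])
    moreover have "q g = q f / N"
    proof -
      have "ham J h L g s = ham J h L f s / sqrt N" if "s \<in> configs L" for s
        using ham_cong[of L g "\<lambda>s. (1 / sqrt N) * f s" s J h] that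
        unfolding ham_scale by (simp add: g_def)
      then show ?thesis using N by (simp add: q_def g_def sum_divide_distrib)
    qed
    ultimately have "q v \<le> q f / N" using v(2) by fastforce
    then show ?thesis using N by (simp add: N_def field_simps)
  qed
  have "ham J h L v s = q v * v s" if s: "s \<in> configs L" for s
  proof -
    define e where "e x = (if x = s then 1 else (0::real))" for x
    define B where "B = ham J h L v s - q v * v s"
    define C where "C = q e - q v"
    have e1: "(\<Sum>x\<in>configs L. e x * f x) = f s" for f
      using s by (simp add: e_def if_distrib[of "\<lambda>x. x * _"] sum.delta cong: if_cong)
    \<comment> \<open>Minimality for \<open>v + t e\<close> at every \<open>t\<close>: a quadratic
      polynomial in \<open>t\<close> without constant term stays nonnegative, so its linear
      coefficient \<open>B\<close> must vanish.\<close>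
    have quad: "0 \<le> 2 * t * B + t\<^sup>2 * C" for t
    proof -
      let ?f = "\<lambda>x. v x + t * e x"
      have "(\<Sum>x\<in>configs L. (?f x)\<^sup>2)
          = (\<Sum>x\<in>configs L. (v x)\<^sup>2 + (2 * t * (e x * v x) + t\<^sup>2 * (e x * e x)))"
        by (intro sum.cong) (auto simp: power2_eq_square algebra_simps)
      also have "\<dots> = 1 + 2 * t * v s + t\<^sup>2"
        unfolding sum.distrib sum_distrib_left[symmetric] e1 v1 by (simp add: e_def)
      finally have "(\<Sum>x\<in>configs L. (?f x)\<^sup>2) = 1 + 2 * t * v s + t\<^sup>2" .
      moreover have "q ?f = q v + 2 * t * ham J h L v s + t\<^sup>2 * q e"
      proof -
        have "q ?f = (\<Sum>x\<in>configs L. v x * ham J h L v x) + t * (\<Sum>x\<in>configs L. v x * ham J h L e x)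
            + t * (\<Sum>x\<in>configs L. e x * ham J h L v x) + t\<^sup>2 * (\<Sum>x\<in>configs L. e x * ham J h L e x)"
          unfolding q_def ham_linear
          by (simp add: sum.distrib sum_distrib_left power2_eq_square algebra_simps)
        then show ?thesis
          using ham_symmetric[of v J h L e] e1[of "ham J h L v"] by (simp add: q_def)
      qed
      ultimately show ?thesis using low[of ?f] by (simp add: B_def C_def algebra_simps)
    qed
    have C: "C \<ge> 0" using quad[of 1] quad[of "-1"] by simp
    have "B = 0"
    proof (rule ccontr)
      assume "B \<noteq> 0"
      \<comment> \<open>Chosen small enough that at \<open>t = - B * d\<close> the linear term
        outweighs the quadratic one.\<close>
      define d where "d = 1 / (C + 1)"
      have d: "d > 0" "d * C \<le> 1" using C by (auto simp: d_def field_simps)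
      have "2 * (- B * d) * B + (- B * d)\<^sup>2 * C = B\<^sup>2 * d * (d * C - 2)"
        by (simp add: power2_eq_square algebra_simps)
      also have "\<dots> < 0" using d \<open>B \<noteq> 0\<close> by (intro mult_pos_neg) auto
      finally show False using quad[of "- B * d"] by linarith
    qed
    then show ?thesis by (simp add: B_def)
  qed
  then show ?thesis using v1 low unfolding q_def by blast
qed

text \<open>Needed because the ground energy is a \<open>Min\<close>. Unit eigenvectors of distinct
  eigenvalues are orthonormal; Bessel's inequality for each basis vector, summed over the
  configurations, bounds their number by the dimension.\<close>

lemma finite_eigenvalues: "finite {E. is_eigenvalue J h L E}"
proof (rule ccontr)
  assume "infinite {E. is_eigenvalue J h L E}"
  then obtain T where T: "T \<subseteq> {E. is_eigenvalue J h L E}" "finite T" "card T = Suc (card (configs L))"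
    using infinite_arbitrarily_large by blast
  have "\<exists>v. (\<Sum>s\<in>configs L. (v s)\<^sup>2) = 1 \<and> (\<forall>s\<in>configs L. ham J h L v s = E * v s)" if "E \<in> T" for E
  proof -
    have "is_eigenvalue J h L E" using T that by auto
    then obtain v where v: "\<exists>s\<in>configs L. v s \<noteq> 0" "\<And>s. s \<in> configs L \<Longrightarrow> ham J h L v s = E * v s"
      unfolding is_eigenvalue_def by blast
    define N where "N = (\<Sum>s\<in>configs L. (v s)\<^sup>2)"
    have "N > 0" unfolding N_def using v(1) by (auto intro: sum_pos2)
    then have "(\<Sum>s\<in>configs L. ((1 / sqrt N) * v s)\<^sup>2) = 1"
      by (simp add: power_divide sum_divide_distrib[symmetric] N_def[symmetric])
    moreover have "ham J h L (\<lambda>s. (1 / sqrt N) * v s) s = E * ((1 / sqrt N) * v s)" if "s \<in> configs L" for s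
      unfolding ham_scale using v(2)[OF that] by simp
    ultimately show ?thesis by (intro exI[of _ "\<lambda>s. (1 / sqrt N) * v s"]) blast
  qed
  then obtain v where v: "\<And>E. E \<in> T \<Longrightarrow> (\<Sum>s\<in>configs L. (v E s)\<^sup>2) = 1"
     "\<And>E s. E \<in> T \<Longrightarrow> s \<in> configs L \<Longrightarrow> ham J h L (v E) s = E * v E s"
    by metis
  have orth: "(\<Sum>s\<in>configs L. v E s * v E' s) = (if E = E' then 1 else 0)" if "E \<in> T" "E' \<in> T" for E E'
  proof -
    have "E' * (\<Sum>s\<in>configs L. v E s * v E' s) = E * (\<Sum>s\<in>configs L. v E s * v E' s)"
      using ham_symmetric[of "v E" J h L "v E'"] that v(2) by (simp add: sum_distrib_left mult_ac)
    then show ?thesis using v(1)[OF that(1)] by (auto simp: power2_eq_square)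
  qed
  have bessel: "(\<Sum>E\<in>T. (v E s)\<^sup>2) \<le> 1" if s: "s \<in> configs L" for s
  proof -
    define e where "e x = (if x = s then 1 else (0::real))" for x
    have e1: "(\<Sum>x\<in>configs L. e x * f x) = f s" for f
      using s by (simp add: e_def if_distrib[of "\<lambda>x. x * _"] sum.delta cong: if_cong)
    \<comment> \<open>The projection of the basis vector \<open>e\<close> to the span of the
      eigenvectors; Bessel's inequality is the nonnegativity of \<open>|e - p|^2\<close>.\<close>
    define p where "p x = (\<Sum>E\<in>T. v E s * v E x)" for x
    have "(\<Sum>x\<in>configs L. p x * p x) = (\<Sum>x\<in>configs L. \<Sum>E\<in>T. \<Sum>E'\<in>T. v E s * v E' s * (v E x * v E' x))"
      by (simp add: p_def sum_product mult_ac)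
    also have "\<dots> = (\<Sum>E\<in>T. \<Sum>x\<in>configs L. \<Sum>E'\<in>T. v E s * v E' s * (v E x * v E' x))"
      by (rule sum.swap)
    also have "\<dots> = (\<Sum>E\<in>T. \<Sum>E'\<in>T. \<Sum>x\<in>configs L. v E s * v E' s * (v E x * v E' x))"
      by (intro sum.cong refl) (rule sum.swap)
    also have "\<dots> = (\<Sum>E\<in>T. \<Sum>E'\<in>T. if E' = E then v E s * v E' s else 0)"
      using orth by (intro sum.cong) (auto simp: sum_distrib_left[symmetric])
    also have "\<dots> = p s" using T(2) by (simp add: p_def)
    finally have pp: "(\<Sum>x\<in>configs L. p x * p x) = p s" .
    have "0 \<le> (\<Sum>x\<in>configs L. (e x - p x)\<^sup>2)" by (simp add: sum_nonneg)
    also have "\<dots> = (\<Sum>x\<in>configs L. e x * e x) - 2 * (\<Sum>x\<in>configs L. e x * p x) + (\<Sum>x\<in>configs L. p x * p x)"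
      by (simp add: power2_eq_square algebra_simps sum.distrib sum_subtractf sum_distrib_left)
    also have "\<dots> = 1 - p s" using pp e1[of p] e1[of e] by (simp add: e_def[of s])
    finally show ?thesis by (simp add: p_def power2_eq_square)
  qed
  have "real (card T) = (\<Sum>E\<in>T. \<Sum>s\<in>configs L. (v E s)\<^sup>2)" using v(1) by simp
  also have "\<dots> = (\<Sum>s\<in>configs L. \<Sum>E\<in>T. (v E s)\<^sup>2)" by (rule sum.swap)
  also have "\<dots> \<le> (\<Sum>s\<in>configs L. 1)" by (intro sum_mono bessel)
  finally show False using T(3) by simp
qed

text \<open>Identifies the minimum of the spectrum with the minimum of the quadratic form, so that
  the variational inequality becomes available for \<open>ground_energy\<close>.\<close>

lemma ground_state_exists:
  "\<exists>v. v \<in> ground_space J h L \<and> (\<Sum>s\<in>configs L. (v s)\<^sup>2) = 1 \<and>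
     (\<forall>f. ground_energy J h L * (\<Sum>s\<in>configs L. (f s)\<^sup>2) \<le> (\<Sum>s\<in>configs L. f s * ham J h L f s))"
proof -
  obtain E v where v: "(\<Sum>s\<in>configs L. (v s)\<^sup>2) = 1"
    "\<And>s. s \<in> configs L \<Longrightarrow> ham J h L v s = E * v s"
    "\<And>f. E * (\<Sum>s\<in>configs L. (f s)\<^sup>2) \<le> (\<Sum>s\<in>configs L. f s * ham J h L f s)"
    using ham_lowest_eigenvector[of L J h] by blast
  have "ground_energy J h L = E"
    unfolding ground_energy_def
  proof (rule Min_eqI)
    show "finite {E. is_eigenvalue J h L E}" by (rule finite_eigenvalues)
    have "\<exists>s\<in>configs L. v s \<noteq> 0"
    proof (rule ccontr)
      assume "\<not> (\<exists>s\<in>configs L. v s \<noteq> 0)"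
      then have "(\<Sum>s\<in>configs L. (v s)\<^sup>2) = 0" by simp
      then show False using v(1) by simp
    qed
    then show "E \<in> {E. is_eigenvalue J h L E}" using v(2) by (auto simp: is_eigenvalue_def)
    fix E' assume "E' \<in> {E. is_eigenvalue J h L E}"
    then obtain f where f: "\<exists>s\<in>configs L. f s \<noteq> 0" "\<And>s. s \<in> configs L \<Longrightarrow> ham J h L f s = E' * f s"
      by (auto simp: is_eigenvalue_def)
    have "(\<Sum>s\<in>configs L. (f s)\<^sup>2) > 0" using f(1) by (auto intro: sum_pos2)
    moreover have "E * (\<Sum>s\<in>configs L. (f s)\<^sup>2) \<le> E' * (\<Sum>s\<in>configs L. (f s)\<^sup>2)"
      using v(3)[of f] f(2) by (simp add: sum_distrib_left power2_eq_square mult_ac)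
    ultimately show "E \<le> E'" by simp
  qed
  then show ?thesis using v by (auto simp: ground_space_def)
qed

section \<open>The ground state\<close>

text \<open>The field is \<open>\<kappa> * \<mu>\<close> and the exchange coupling is
  \<open>- \<kappa> * \<nu>\<close> for a scale \<open>\<kappa> > 0\<close>. The second assumption
  is the disordered regime; the first fixes the scale so that the matrix series converge.\<close>

locale ising_couplings =
  fixes \<mu> \<nu> :: real
  assumes normalized: "\<bar>\<mu>\<bar> + \<bar>\<nu>\<bar> = 1" and gapped: "\<bar>\<nu>\<bar> < \<bar>\<mu>\<bar>"
begin

text \<open>Up to the factor \<open>- 2 * \<kappa>\<close>, column \<open>k\<close> holds the
  coefficients of the commutator of the Hamiltonian with \<open>maj_a\<close> at \<open>k\<close>,
  and row \<open>j\<close> those of the commutator with \<open>maj_b\<close> at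
  \<open>j\<close>.\<close>

definition M :: "int \<Rightarrow> int \<Rightarrow> real" where
  "M i j = (if j = i then \<mu> else if j = i + 1 then \<nu> else 0)"

text \<open>This is \<open>1 - M^T M\<close> on the box. It is Toeplitz except at the left end,
  where \<open>M\<close> has no predecessor row to contribute.\<close>

definition X :: "nat \<Rightarrow> int \<Rightarrow> int \<Rightarrow> real" where
  "X L i j = (if i = j then 1 - \<mu>\<^sup>2 - (if i > - int L then \<nu>\<^sup>2 else 0)
     else if i = j + 1 \<or> j = i + 1 then - \<mu> * \<nu> else 0)"

text \<open>By the normalisation, \<open>1 - \<theta>\<close> is the square of
  \<open>\<bar>\<mu>\<bar> - \<bar>\<nu>\<bar>\<close>.\<close>

definition \<theta> :: real where
  "\<theta> = 4 * \<bar>\<mu>\<bar> * \<bar>\<nu>\<bar>"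

lemma theta_nonneg: "0 \<le> \<theta>"
  by (simp add: \<theta>_def)

lemma theta_less_1: "\<theta> < 1"
proof -
  have "(\<bar>\<mu>\<bar> - \<bar>\<nu>\<bar>)\<^sup>2 > 0" using gapped by simp
  moreover have "(\<bar>\<mu>\<bar> + \<bar>\<nu>\<bar>)\<^sup>2 = 1" using normalized by simp
  ultimately show ?thesis by (simp add: \<theta>_def power2_eq_square algebra_simps)
qed

lemma sum_M_left:
  assumes "k \<in> box L"
  shows "(\<Sum>j\<in>box L. M j k * c j) = \<mu> * c k + (if k > - int L then \<nu> * c (k - 1) else 0)"
proof -
  have "(\<Sum>j\<in>box L. M j k * c j) = (\<Sum>j\<in>box L. (if j = k then \<mu> * c j else 0) + (if j = k - 1 then \<nu> * c j else 0))"
    by (intro sum.cong) (auto simp: M_def)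
  also have "\<dots> = \<mu> * c k + (if k - 1 \<in> box L then \<nu> * c (k - 1) else 0)"
    using assms by (simp add: sum.distrib sum.delta')
  finally show ?thesis using assms by (auto simp: box_def)
qed

lemma sum_M_right:
  assumes "j \<in> box L"
  shows "(\<Sum>k\<in>box L. M j k * c k) = \<mu> * c j + (if j < int L then \<nu> * c (j + 1) else 0)"
proof -
  have "(\<Sum>k\<in>box L. M j k * c k) = (\<Sum>k\<in>box L. (if k = j then \<mu> * c k else 0) + (if k = j + 1 then \<nu> * c k else 0))"
    by (intro sum.cong) (auto simp: M_def)
  also have "\<dots> = \<mu> * c j + (if j + 1 \<in> box L then \<nu> * c (j + 1) else 0)"
    using assms by (simp add: sum.distrib sum.delta')
  finally show ?thesis using assms by (auto simp: box_def)
qed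

lemma MtM:
  assumes "i \<in> box L" "j \<in> box L"
  shows "(\<Sum>l\<in>box L. M l i * M l j) = mid i j - X L i j"
  unfolding sum_M_left[OF assms(1)] using assms
  by (auto simp: M_def X_def mid_def power2_eq_square box_def)

lemma X_row_sum:
  assumes "i \<in> box L"
  shows "(\<Sum>j\<in>box L. \<bar>X L i j\<bar>) \<le> \<theta>"
proof -
  have sq: "\<mu>\<^sup>2 + \<nu>\<^sup>2 + 2 * (\<bar>\<mu>\<bar> * \<bar>\<nu>\<bar>) = 1"
  proof -
    have "(\<bar>\<mu>\<bar> + \<bar>\<nu>\<bar>)\<^sup>2 = 1" using normalized by simp
    then show ?thesis by (simp add: power2_sum)
  qed
  have nn: "0 \<le> \<bar>\<mu>\<bar> * \<bar>\<nu>\<bar>" by simp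
  have nu: "\<nu>\<^sup>2 \<le> \<bar>\<mu>\<bar> * \<bar>\<nu>\<bar>"
    using mult_right_mono[of "\<bar>\<nu>\<bar>" "\<bar>\<mu>\<bar>" "\<bar>\<nu>\<bar>"] gapped by (simp add: power2_eq_square)
  have "(\<Sum>j\<in>box L. \<bar>X L i j\<bar>) = (\<Sum>j\<in>box L. (if j = i then \<bar>X L i i\<bar> else 0)
      + (if j = i - 1 then \<bar>\<mu>\<bar> * \<bar>\<nu>\<bar> else 0) + (if j = i + 1 then \<bar>\<mu>\<bar> * \<bar>\<nu>\<bar> else 0))"
    by (intro sum.cong) (auto simp: X_def abs_mult)
  also have "\<dots> = \<bar>X L i i\<bar> + (if i - 1 \<in> box L then \<bar>\<mu>\<bar> * \<bar>\<nu>\<bar> else 0) + (if i + 1 \<in> box L then \<bar>\<mu>\<bar> * \<bar>\<nu>\<bar> else 0)"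
    using assms by (simp add: sum.distrib sum.delta')
  also have "\<dots> \<le> 4 * (\<bar>\<mu>\<bar> * \<bar>\<nu>\<bar>)"
  proof (cases "i > - int L")
    case True
    then have "X L i i = 2 * (\<bar>\<mu>\<bar> * \<bar>\<nu>\<bar>)" using sq by (simp add: X_def)
    then have "\<bar>X L i i\<bar> = 2 * (\<bar>\<mu>\<bar> * \<bar>\<nu>\<bar>)" using nn by simp
    then show ?thesis using nn by simp
  next
    \<comment> \<open>At the left end the diagonal entry grows by \<open>\<nu>\<^sup>2\<close>,
      which the gap condition bounds by the off-diagonal entry that is missing there.\<close>
    case False
    then have "X L i i = \<nu>\<^sup>2 + 2 * (\<bar>\<mu>\<bar> * \<bar>\<nu>\<bar>)" using sq by (simp add: X_def)
    then have "\<bar>X L i i\<bar> = \<nu>\<^sup>2 + 2 * (\<bar>\<mu>\<bar> * \<bar>\<nu>\<bar>)" using nn by simp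
    moreover have "i - 1 \<notin> box L" using False by (simp add: box_def)
    moreover have "\<nu>\<^sup>2 \<le> 2 * (\<bar>\<mu>\<bar> * \<bar>\<nu>\<bar>)" using nu nn by linarith
    ultimately show ?thesis using nu by simp
  qed
  finally show ?thesis by (simp add: \<theta>_def)
qed

sublocale ssm: small_symmetric_matrix "box L" "X L" \<theta> for L
  by unfold_locales (simp_all add: theta_nonneg theta_less_1 X_row_sum, auto simp: X_def)

text \<open>The orthogonal factor \<open>A = R M^T\<close> in the polar decomposition
  \<open>M^T = P A\<close>.\<close>

definition A :: "nat \<Rightarrow> int \<Rightarrow> int \<Rightarrow> real" where
  "A L i j = (\<Sum>l\<in>box L. ssm.R L i l * M j l)"

lemma A_eq:
  "j \<in> box L \<Longrightarrow> A L i j = \<mu> * ssm.R L i j + (if j < int L then \<nu> * ssm.R L i (j + 1) else 0)"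
  using sum_M_right[of j L "ssm.R L i"] by (simp add: A_def mult.commute)

lemma A_M:
  assumes "k \<in> box L" "l \<in> box L"
  shows "(\<Sum>j\<in>box L. A L k j * M j l) = ssm.P L k l"
proof -
  have "(\<Sum>j\<in>box L. A L k j * M j l) = (\<Sum>j\<in>box L. \<Sum>m\<in>box L. ssm.R L k m * (M j m * M j l))"
    by (simp add: A_def sum_distrib_right sum_distrib_left mult_ac)
  also have "\<dots> = (\<Sum>m\<in>box L. ssm.R L k m * (\<Sum>j\<in>box L. M j m * M j l))"
    by (subst sum.swap) (simp add: sum_distrib_left)
  also have "\<dots> = (\<Sum>m\<in>box L. ssm.R L k m * (mid m l - X L m l))"
    using assms by (intro sum.cong) (auto simp: MtM)
  also have "\<dots> = mmul (box L) (ssm.R L) mid k l - mmul (box L) (ssm.R L) (X L) k l"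
    by (simp add: mmul_def right_diff_distrib sum_subtractf)
  finally show ?thesis using assms by (simp add: ssm.P_def mmul_mid_right)
qed

lemma P_A:
  assumes "k \<in> box L" "j \<in> box L"
  shows "(\<Sum>l\<in>box L. ssm.P L k l * A L l j) = M j k"
proof -
  have "(\<Sum>l\<in>box L. ssm.P L k l * A L l j) = mmul (box L) (ssm.P L) (mmul (box L) (ssm.R L) (\<lambda>l j. M j l)) k j"
    by (simp add: mmul_def A_def)
  also have "\<dots> = mmul (box L) (mmul (box L) (ssm.P L) (ssm.R L)) (\<lambda>l j. M j l) k j"
    by (rule mmul_assoc[symmetric])
  also have "\<dots> = mmul (box L) mid (\<lambda>l j. M j l) k j"
    using assms by (intro mmul_cong) (auto simp: ssm.PR_eq_mid)
  finally show ?thesis using assms by (simp add: mmul_mid_left)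
qed

text \<open>\<open>A A^T = (A M) R = P R = 1\<close>, using the symmetry of
  \<open>R\<close>.\<close>

lemma A_orthogonal:
  assumes "i \<in> box L" "j \<in> box L"
  shows "(\<Sum>l\<in>box L. A L i l * A L j l) = mid i j"
proof -
  have "(\<Sum>l\<in>box L. A L i l * A L j l) = (\<Sum>l\<in>box L. \<Sum>m\<in>box L. (A L i l * M l m) * ssm.R L j m)"
    by (simp add: A_def[of L j] sum_distrib_left mult_ac)
  also have "\<dots> = (\<Sum>m\<in>box L. (\<Sum>l\<in>box L. A L i l * M l m) * ssm.R L j m)"
    by (subst sum.swap) (simp add: sum_distrib_right)
  also have "\<dots> = mmul (box L) (ssm.P L) (ssm.R L) i j"
    unfolding mmul_def using assms by (intro sum.cong) (auto simp: A_M ssm.R_sym)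
  finally show ?thesis using assms by (simp add: ssm.PR_eq_mid)
qed

text \<open>Orthogonality of the rows makes the transpose an isometry; the bound then passes to
  \<open>A\<close> by transposition.\<close>

lemma A_contractive: "contractive (box L) (A L)"
proof -
  have "contractive (box L) (\<lambda>i j. A L j i)"
    unfolding contractive_def
  proof
    fix y :: "int \<Rightarrow> real"
    have "(\<Sum>i\<in>box L. (\<Sum>j\<in>box L. A L j i * y j)\<^sup>2)
        = (\<Sum>i\<in>box L. \<Sum>j\<in>box L. \<Sum>k\<in>box L. y j * y k * (A L j i * A L k i))"
      by (simp add: power2_eq_square sum_product mult_ac)
    also have "\<dots> = (\<Sum>j\<in>box L. \<Sum>i\<in>box L. \<Sum>k\<in>box L. y j * y k * (A L j i * A L k i))"
      by (rule sum.swap)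
    also have "\<dots> = (\<Sum>j\<in>box L. \<Sum>k\<in>box L. \<Sum>i\<in>box L. y j * y k * (A L j i * A L k i))"
      by (rule sum.cong[OF refl], rule sum.swap)
    also have "\<dots> = (\<Sum>j\<in>box L. \<Sum>k\<in>box L. if k = j then y j * y k else 0)"
      by (intro sum.cong) (auto simp: sum_distrib_left[symmetric] A_orthogonal mid_def)
    also have "\<dots> = (\<Sum>j\<in>box L. (y j)\<^sup>2)"
      by (simp add: power2_eq_square)
    finally show "(\<Sum>i\<in>box L. (\<Sum>j\<in>box L. A L j i * y j)\<^sup>2) \<le> (\<Sum>j\<in>box L. (y j)\<^sup>2)" by simp
  qed
  from contractive_transpose[OF this] show ?thesis by simp
qed

section \<open>Positivity of \<open>P\<close> and uniqueness of the ground vector\<close>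

lemma P_form_ge:
  "(1 - \<theta>) * (\<Sum>k\<in>box L. (y k)\<^sup>2) \<le> (\<Sum>k\<in>box L. \<Sum>l\<in>box L. ssm.P L k l * y k * y l)"
proof -
  have "(\<Sum>k\<in>box L. \<Sum>l\<in>box L. (mid k l - ssm.P L k l) * y k * y l) \<le> \<theta> * (\<Sum>k\<in>box L. (y k)\<^sup>2)"
    by (rule symmetric_form_le) (auto simp: ssm.P_sym mid_commute ssm.mid_minus_P_row)
  moreover have "(\<Sum>k\<in>box L. \<Sum>l\<in>box L. (mid k l - ssm.P L k l) * y k * y l)
      = (\<Sum>k\<in>box L. y k * mmul (box L) mid (\<lambda>l _. y l) k k) - (\<Sum>k\<in>box L. \<Sum>l\<in>box L. ssm.P L k l * y k * y l)"
    by (simp add: mmul_def sum_distrib_left sum_subtractf[symmetric] algebra_simps)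
  ultimately show ?thesis
    by (simp add: mmul_mid_left power2_eq_square algebra_simps cong: sum.cong)
qed

text \<open>Applying \<open>P\<close> gives \<open>P y = - sgn \<mu> * M^T y\<close>. Paired with
  \<open>y\<close>, the left side is at least \<open>(1 - \<theta>) |y|^2\<close>, while the right
  side is at most \<open>(\<bar>\<nu>\<bar> - \<bar>\<mu>\<bar>) |y|^2\<close>, which is
  nonpositive.\<close>

lemma A_no_fixed_vector:
  assumes y: "\<And>k. k \<in> box L \<Longrightarrow> y k = - sgn \<mu> * (\<Sum>j\<in>box L. A L k j * y j)" and k: "k \<in> box L"
  shows "y k = 0"
proof -
  let ?N = "\<Sum>k\<in>box L. (y k)\<^sup>2"
  have "(\<Sum>l\<in>box L. ssm.P L k l * y l) = - sgn \<mu> * (\<Sum>j\<in>box L. M j k * y j)" if "k \<in> box L" for k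
  proof -
    have "(\<Sum>l\<in>box L. ssm.P L k l * y l) = (\<Sum>l\<in>box L. ssm.P L k l * (- sgn \<mu> * (\<Sum>j\<in>box L. A L l j * y j)))"
      by (rule sum.cong[OF refl], subst y) auto
    also have "\<dots> = - sgn \<mu> * (\<Sum>l\<in>box L. \<Sum>j\<in>box L. ssm.P L k l * A L l j * y j)"
      by (simp add: sum_distrib_left mult_ac)
    also have "(\<Sum>l\<in>box L. \<Sum>j\<in>box L. ssm.P L k l * A L l j * y j) = (\<Sum>j\<in>box L. (\<Sum>l\<in>box L. ssm.P L k l * A L l j) * y j)"
      by (subst sum.swap) (simp add: sum_distrib_right)
    finally show ?thesis using that by (simp add: P_A)
  qed
  then have "(\<Sum>k\<in>box L. \<Sum>l\<in>box L. ssm.P L k l * y k * y l)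
      = (\<Sum>k\<in>box L. y k * (- sgn \<mu> * (\<Sum>j\<in>box L. M j k * y j)))"
    by (auto intro!: sum.cong simp: sum_distrib_left[symmetric] mult_ac)
  also have "\<dots> = - sgn \<mu> * (\<Sum>k\<in>box L. \<Sum>j\<in>box L. M j k * y j * y k)"
    by (simp add: sum_distrib_left mult_ac)
  also have "(\<Sum>k\<in>box L. \<Sum>j\<in>box L. M j k * y j * y k) = (\<Sum>j\<in>box L. y j * (\<Sum>k\<in>box L. M j k * y k))"
    by (subst sum.swap) (simp add: sum_distrib_left mult_ac)
  also have "\<dots> = (\<Sum>j\<in>box L. \<mu> * (y j)\<^sup>2 + (if j < int L then \<nu> * (y j * y (j + 1)) else 0))"
    by (rule sum.cong[OF refl], subst sum_M_right) (auto simp: power2_eq_square algebra_simps)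
  also have "\<dots> = \<mu> * ?N + (\<Sum>j\<in>box L. if j < int L then \<nu> * (y j * y (j + 1)) else 0)"
    by (simp add: sum.distrib sum_distrib_left)
  also have "- sgn \<mu> * (\<mu> * ?N + (\<Sum>j\<in>box L. if j < int L then \<nu> * (y j * y (j + 1)) else 0))
      \<le> - \<bar>\<mu>\<bar> * ?N + \<bar>\<nu>\<bar> * ?N"
  proof -
    have shift: "(\<Sum>j\<in>box L. if j < int L then (y (j + 1))\<^sup>2 else 0) \<le> ?N"
    proof -
      have "(\<Sum>j\<in>box L. if j < int L then (y (j + 1))\<^sup>2 else 0) = (\<Sum>j\<in>{- int L..<int L}. (y (j + 1))\<^sup>2)"
        by (intro sum.mono_neutral_cong_right) (auto simp: box_def)
      also have "\<dots> = (\<Sum>j\<in>{- int L + 1..int L}. (y j)\<^sup>2)"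
        by (rule sum.reindex_bij_witness[of _ "\<lambda>j. j - 1" "\<lambda>j. j + 1"]) auto
      also have "\<dots> \<le> ?N" by (intro sum_mono2) (auto simp: box_def)
      finally show ?thesis .
    qed
    have "\<bar>\<Sum>j\<in>box L. if j < int L then \<nu> * (y j * y (j + 1)) else 0\<bar>
        \<le> (\<Sum>j\<in>box L. \<bar>if j < int L then \<nu> * (y j * y (j + 1)) else 0\<bar>)"
      by (rule sum_abs)
    also have "\<dots> \<le> (\<Sum>j\<in>box L. \<bar>\<nu>\<bar> * (((y j)\<^sup>2 + (if j < int L then (y (j + 1))\<^sup>2 else 0)) / 2))"
    proof (rule sum_mono)
      fix j
      have "\<bar>a * b\<bar> \<le> (a\<^sup>2 + b\<^sup>2) / 2" for a b :: real
        using sum_squares_bound[of "\<bar>a\<bar>" "\<bar>b\<bar>"] by (simp add: abs_mult)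
      then show "\<bar>if j < int L then \<nu> * (y j * y (j + 1)) else 0\<bar>
          \<le> \<bar>\<nu>\<bar> * (((y j)\<^sup>2 + (if j < int L then (y (j + 1))\<^sup>2 else 0)) / 2)"
        using mult_left_mono[of "\<bar>y j * y (j + 1)\<bar>" "((y j)\<^sup>2 + (y (j + 1))\<^sup>2) / 2" "\<bar>\<nu>\<bar>"]
        by (simp add: abs_mult[of \<nu>])
    qed
    also have "\<dots> = \<bar>\<nu>\<bar> * ((?N + (\<Sum>j\<in>box L. if j < int L then (y (j + 1))\<^sup>2 else 0)) / 2)"
      by (simp add: sum_distrib_left[symmetric] sum_divide_distrib[symmetric] sum.distrib)
    also have "\<dots> \<le> \<bar>\<nu>\<bar> * ?N"
      using shift by (intro mult_left_mono) auto
    finally have *: "\<bar>\<Sum>j\<in>box L. if j < int L then \<nu> * (y j * y (j + 1)) else 0\<bar> \<le> \<bar>\<nu>\<bar> * ?N" .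
    have "\<mu> \<noteq> 0" using gapped by auto
    then have "\<bar>sgn \<mu>\<bar> = 1" by (simp add: abs_sgn_eq)
    then have "- sgn \<mu> * b \<le> \<bar>b\<bar>" for b
      by (metis abs_ge_self abs_minus_cancel abs_mult mult_1)
    moreover have "sgn \<mu> * \<mu> = \<bar>\<mu>\<bar>" by (simp add: abs_sgn mult.commute)
    then have "- sgn \<mu> * (\<mu> * ?N) = - \<bar>\<mu>\<bar> * ?N" by (metis mult.assoc mult_minus_left)
    ultimately show ?thesis using * unfolding distrib_left by (smt (verit))
  qed
  finally have "(\<Sum>k\<in>box L. \<Sum>l\<in>box L. ssm.P L k l * y k * y l) \<le> (\<bar>\<nu>\<bar> - \<bar>\<mu>\<bar>) * ?N"
    by (simp add: algebra_simps)
  moreover have N0: "?N \<ge> 0" by (simp add: sum_nonneg)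
  moreover have "(\<bar>\<nu>\<bar> - \<bar>\<mu>\<bar>) * ?N \<le> 0" using gapped N0 by (simp add: mult_nonpos_nonneg)
  ultimately have "(1 - \<theta>) * ?N \<le> 0" using P_form_ge[of y L] by linarith
  then have "?N = 0" using theta_less_1 N0 by (simp add: mult_le_0_iff)
  then show ?thesis using k by (simp add: sum_nonneg_eq_0_iff)
qed

text \<open>Applied to the vectors \<open>\<xi>\<^sub>k = maj_a k v + (\<Sum>j. A k j * maj_b j v)\<close>, the Hamiltonian minus its lowest
  eigenvalue acts as a negative definite matrix, so they must all vanish.\<close>

lemma ground_relation:
  assumes \<kappa>: "\<kappa> > 0" "h = \<kappa> * \<mu>" "J = - \<kappa> * \<nu>"
    and v: "\<And>s. s \<in> configs L \<Longrightarrow> ham J h L v s = E * v s"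
    and E: "\<And>f. E * (\<Sum>s\<in>configs L. (f s)\<^sup>2) \<le> (\<Sum>s\<in>configs L. f s * ham J h L f s)"
    and k: "k \<in> box L" and s: "s \<in> configs L"
  shows "maj_a L k v s + (\<Sum>j\<in>box L. A L k j * maj_b L j v s) = 0"
proof -
  define \<xi> where "\<xi> k s = maj_a L k v s + (\<Sum>j\<in>box L. A L k j * maj_b L j v s)" for k s
  have ham_a: "ham J h L (maj_a L k v) s = E * maj_a L k v s - 2 * \<kappa> * (\<Sum>j\<in>box L. M j k * maj_b L j v s)"
    if "k \<in> box L" "s \<in> configs L" for k s
  proof -
    have "maj_a L k (ham J h L v) s = E * maj_a L k v s" using that v by (simp add: maj_a_def)
    then show ?thesis
      unfolding ham_maj_a[OF that(1)] sum_M_left[OF that(1)] using \<kappa> by (simp add: algebra_simps)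
  qed
  have ham_b: "ham J h L (maj_b L j v) s = E * maj_b L j v s - 2 * \<kappa> * (\<Sum>k\<in>box L. M j k * maj_a L k v s)"
    if "j \<in> box L" "s \<in> configs L" for j s
  proof -
    have "maj_b L j (ham J h L v) s = E * maj_b L j v s" using that v by (simp add: maj_b_def maj_a_def)
    then show ?thesis
      unfolding ham_maj_b[OF that(1)] sum_M_right[OF that(1)] using \<kappa> by (simp add: algebra_simps)
  qed
  \<comment> \<open>The identities \<open>A M = P\<close> and \<open>P A = M^T\<close> close the
    commutators on the vectors \<open>\<xi>\<close>: the Hamiltonian minus \<open>E\<close> acts on
    them as \<open>- 2 * \<kappa> * P\<close>.\<close>
  have ham_chi: "ham J h L (\<xi> k) s = E * \<xi> k s - 2 * \<kappa> * (\<Sum>l\<in>box L. ssm.P L k l * \<xi> l s)"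
    if k: "k \<in> box L" and s: "s \<in> configs L" for k s
  proof -
    have "ham J h L (\<xi> k) s = ham J h L (maj_a L k v) s + (\<Sum>j\<in>box L. A L k j * ham J h L (maj_b L j v) s)"
      using ham_linear[of J h L "maj_a L k v" 1 "\<lambda>s. \<Sum>j\<in>box L. A L k j * maj_b L j v s" s]
      by (simp add: \<xi>_def[abs_def] ham_sum)
    also have "(\<Sum>j\<in>box L. A L k j * ham J h L (maj_b L j v) s)
        = (\<Sum>j\<in>box L. E * (A L k j * maj_b L j v s) - 2 * \<kappa> * (\<Sum>l\<in>box L. A L k j * M j l * maj_a L l v s))"
      using s by (intro sum.cong) (auto simp: ham_b sum_distrib_left algebra_simps)
    also have "\<dots> = E * (\<Sum>j\<in>box L. A L k j * maj_b L j v s)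
        - 2 * \<kappa> * (\<Sum>j\<in>box L. \<Sum>l\<in>box L. A L k j * M j l * maj_a L l v s)"
      by (simp add: sum_subtractf sum_distrib_left)
    also have "(\<Sum>j\<in>box L. \<Sum>l\<in>box L. A L k j * M j l * maj_a L l v s)
        = (\<Sum>l\<in>box L. (\<Sum>j\<in>box L. A L k j * M j l) * maj_a L l v s)"
      by (subst sum.swap) (simp add: sum_distrib_right)
    also have "\<dots> = (\<Sum>l\<in>box L. ssm.P L k l * maj_a L l v s)"
      using k by (simp add: A_M)
    finally have 1: "ham J h L (\<xi> k) s = E * \<xi> k s - 2 * \<kappa> *
        ((\<Sum>l\<in>box L. ssm.P L k l * maj_a L l v s) + (\<Sum>j\<in>box L. M j k * maj_b L j v s))"
      using ham_a[OF k s] unfolding \<xi>_def[of k s] by (simp add: algebra_simps)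
    have "(\<Sum>j\<in>box L. M j k * maj_b L j v s) = (\<Sum>j\<in>box L. (\<Sum>l\<in>box L. ssm.P L k l * A L l j) * maj_b L j v s)"
      using k by (simp add: P_A)
    also have "\<dots> = (\<Sum>j\<in>box L. \<Sum>l\<in>box L. ssm.P L k l * (A L l j * maj_b L j v s))"
      by (simp add: sum_distrib_right mult.assoc)
    also have "\<dots> = (\<Sum>l\<in>box L. ssm.P L k l * (\<Sum>j\<in>box L. A L l j * maj_b L j v s))"
      by (subst sum.swap) (simp add: sum_distrib_left)
    finally show ?thesis unfolding 1
      by (simp add: \<xi>_def distrib_left sum.distrib)
  qed
  \<comment> \<open>The variational inequality for \<open>\<xi> k\<close> alone. Summed over
    \<open>k\<close>, it meets the lower bound of \<open>P\<close>, applied at each configuration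
    separately.\<close>
  have neg: "(\<Sum>s\<in>configs L. \<Sum>l\<in>box L. ssm.P L k l * \<xi> k s * \<xi> l s) \<le> 0" if k: "k \<in> box L" for k
  proof -
    have "(\<Sum>s\<in>configs L. \<xi> k s * ham J h L (\<xi> k) s)
        = (\<Sum>s\<in>configs L. E * (\<xi> k s)\<^sup>2 - 2 * \<kappa> * (\<Sum>l\<in>box L. ssm.P L k l * \<xi> k s * \<xi> l s))"
      by (intro sum.cong) (auto simp: ham_chi[OF k] power2_eq_square sum_distrib_left algebra_simps)
    also have "\<dots> = E * (\<Sum>s\<in>configs L. (\<xi> k s)\<^sup>2) - 2 * \<kappa> * (\<Sum>s\<in>configs L. \<Sum>l\<in>box L. ssm.P L k l * \<xi> k s * \<xi> l s)"
      by (simp add: sum_subtractf sum_distrib_left)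
    finally have "\<kappa> * (\<Sum>s\<in>configs L. \<Sum>l\<in>box L. ssm.P L k l * \<xi> k s * \<xi> l s) \<le> 0"
      using E[of "\<xi> k"] by simp
    then show ?thesis using \<kappa>(1) by (simp add: mult_le_0_iff)
  qed
  have "(1 - \<theta>) * (\<Sum>s\<in>configs L. \<Sum>k\<in>box L. (\<xi> k s)\<^sup>2)
      \<le> (\<Sum>s\<in>configs L. \<Sum>k\<in>box L. \<Sum>l\<in>box L. ssm.P L k l * \<xi> k s * \<xi> l s)"
    unfolding sum_distrib_left[of "1 - \<theta>"] by (intro sum_mono P_form_ge[unfolded sum_distrib_left[of "1 - \<theta>"]])
  also have "\<dots> = (\<Sum>k\<in>box L. \<Sum>s\<in>configs L. \<Sum>l\<in>box L. ssm.P L k l * \<xi> k s * \<xi> l s)"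
    by (rule sum.swap)
  also have "\<dots> \<le> 0" by (intro sum_nonpos neg)
  finally have "(\<Sum>s\<in>configs L. \<Sum>k\<in>box L. (\<xi> k s)\<^sup>2) \<le> 0"
    using theta_less_1 by (simp add: mult_le_0_iff)
  then have "(\<Sum>s\<in>configs L. \<Sum>k\<in>box L. (\<xi> k s)\<^sup>2) = 0"
    by (simp add: order_antisym sum_nonneg)
  then have "(\<xi> k s)\<^sup>2 = 0"
    using k s by (simp add: sum_nonneg_eq_0_iff sum_nonneg)
  then show ?thesis by (simp add: \<xi>_def)
qed

text \<open>Induction on the number of sites where \<open>s\<close> differs from the reference
  configuration. One such site \<open>j\<close> is flipped back to get \<open>s'\<close>. At
  \<open>s'\<close> the values \<open>maj_a L k v s'\<close> vanish for the remaining deviating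
  sites by induction; at all other sites \<open>zval\<close> equals \<open>sgn \<mu>\<close>. The
  relation thus becomes the equation of \<open>A_no_fixed_vector\<close>, and its solution is
  zero.\<close>

lemma relation_determines_vector:
  assumes rel: "\<And>k s. k \<in> box L \<Longrightarrow> s \<in> configs L \<Longrightarrow> maj_a L k v s + (\<Sum>j\<in>box L. A L k j * maj_b L j v s) = 0"
    and ref: "v (\<lambda>i. i \<in> box L \<and> \<mu> > 0) = 0" and s: "s \<in> configs L"
  shows "v s = 0"
proof -
  define D where "D s = {i \<in> box L. s i \<noteq> (\<mu> > 0)}" for s
  have fin: "finite (D s)" for s by (simp add: D_def)
  have "\<mu> \<noteq> 0" using gapped by auto
  show ?thesis using s
  proof (induction "card (D s)" arbitrary: s rule: less_induct)
    case less
    show ?case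
    proof (cases "D s = {}")
      case True
      then have "s = (\<lambda>i. i \<in> box L \<and> \<mu> > 0)"
        using less.prems by (auto simp: D_def configs_def fun_eq_iff)
      then show ?thesis using ref by simp
    next
      case False
      then obtain j where j: "j \<in> D s" by auto
      then have jb: "j \<in> box L" by (simp add: D_def)
      define s' where "s' = flip j s"
      have s': "s' \<in> configs L" using less.prems jb by (simp add: s'_def)
      have D': "D s' = D s - {j}" using j by (auto simp: D_def s'_def flip_apply)
      have zero: "v (flip k s') = 0" if "k \<in> D s'" for k
      proof (rule less.hyps)
        have "D (flip k s') = D s - {j} - {k}" using that D' by (auto simp: D_def flip_apply)
        then show "card (D (flip k s')) < card (D s)" using j fin
          by (auto intro!: psubset_card_mono)
        show "flip k s' \<in> configs L" using that s' by (simp add: D_def)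
      qed
      have maj_b: "maj_b L k v s' = sgn \<mu> * maj_a L k v s'" if "k \<in> box L" for k
      proof (cases "k \<in> D s'")
        case True
        then show ?thesis using zero by (simp add: maj_b_def maj_a_def)
      next
        case False
        then have "zval (s' k) = sgn \<mu>" using that \<open>\<mu> \<noteq> 0\<close> by (auto simp: D_def zval_def sgn_real_def)
        then show ?thesis by (simp add: maj_b_def)
      qed
      have "maj_a L j v s' = 0"
      proof (rule A_no_fixed_vector[OF _ jb])
        fix k assume k: "k \<in> box L"
        have "(\<Sum>j\<in>box L. A L k j * maj_b L j v s') = sgn \<mu> * (\<Sum>j\<in>box L. A L k j * maj_a L j v s')"
          by (simp add: maj_b sum_distrib_left mult_ac)
        then show "maj_a L k v s' = - sgn \<mu> * (\<Sum>j\<in>box L. A L k j * maj_a L j v s')"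
          using rel[OF k s'] by simp
      qed
      then have "jw_sign L j s' * v s = 0" by (simp add: maj_a_def s'_def)
      then show ?thesis by simp
    qed
  qed
qed

text \<open>The ground space is one-dimensional, so the supremum runs over a single value.\<close>

lemma ground_weight_eq:
  assumes \<kappa>: "\<kappa> > 0" "h = \<kappa> * \<mu>" "J = - \<kappa> * \<nu>"
    and v: "v \<in> ground_space J h L" "(\<Sum>s\<in>configs L. (v s)\<^sup>2) = 1" and s: "s \<in> configs L"
  shows "ground_weight J h L s = (v s)\<^sup>2"
proof -
  let ?r = "\<lambda>i. i \<in> box L \<and> \<mu> > 0"
  have r: "?r \<in> configs L" by (auto simp: configs_def)
  have E: "\<And>f. ground_energy J h L * (\<Sum>s\<in>configs L. (f s)\<^sup>2) \<le> (\<Sum>s\<in>configs L. f s * ham J h L f s)"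
    using ground_state_exists[of J h L] by blast
  have unique: "f s = 0" if "f \<in> ground_space J h L" "f ?r = 0" "s \<in> configs L" for f s
  proof (rule relation_determines_vector[where v = f, OF _ that(2,3)])
    fix k s assume "k \<in> box L" "s \<in> configs L"
    then show "maj_a L k f s + (\<Sum>j\<in>box L. A L k j * maj_b L j f s) = 0"
      using that(1) by (intro ground_relation[OF \<kappa> _ E]) (auto simp: ground_space_def)
  qed
  have vr: "v ?r \<noteq> 0"
  proof
    assume "v ?r = 0"
    then have "(\<Sum>s\<in>configs L. (v s)\<^sup>2) = 0" using unique[OF v(1)] by simp
    then show False using v(2) by simp
  qed
  have "(w s)\<^sup>2 = (v s)\<^sup>2" if w: "w \<in> ground_space J h L" "(\<Sum>s\<in>configs L. (w s)\<^sup>2) = 1" for w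
  proof -
    \<comment> \<open>The combination of the two ground vectors that vanishes at the reference
      configuration, hence at all configurations of the box.\<close>
    define f where "f s = w ?r * v s + (- v ?r) * w s" for s
    have "ham J h L f s = ground_energy J h L * f s" if "s \<in> configs L" for s
      using v(1) w(1) that unfolding f_def ham_linear ham_scale
      by (simp add: ground_space_def algebra_simps)
    then have "f \<in> ground_space J h L" by (simp add: ground_space_def)
    moreover have "f ?r = 0" by (simp add: f_def)
    ultimately have eq: "w ?r * v s = v ?r * w s" if "s \<in> configs L" for s
      using unique[of f s] that by (simp add: f_def)
    have "(w ?r)\<^sup>2 * (\<Sum>s\<in>configs L. (v s)\<^sup>2) = (v ?r)\<^sup>2 * (\<Sum>s\<in>configs L. (w s)\<^sup>2)"
      using eq by (simp add: sum_distrib_left power_mult_distrib[symmetric])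
    then have "(w ?r)\<^sup>2 = (v ?r)\<^sup>2" using v(2) w(2) by simp
    moreover have "(w ?r)\<^sup>2 * (v s)\<^sup>2 = (v ?r)\<^sup>2 * (w s)\<^sup>2"
      using eq[OF s] by (simp add: power_mult_distrib[symmetric])
    ultimately show ?thesis using vr by simp
  qed
  then have "{(w s)\<^sup>2 | w. w \<in> ground_space J h L \<and> (\<Sum>x\<in>configs L. (w x)\<^sup>2) = 1} = {(v s)\<^sup>2}"
    using v by blast
  then show ?thesis by (simp add: ground_weight_def)
qed

end

section \<open>The generating function\<close>

text \<open>With \<open>\<tau> j = tr A\<^sup>j\<close> this is \<open>ln det (1 + x A)\<close>.\<close>

definition logdet_series :: "(nat \<Rightarrow> real) \<Rightarrow> real \<Rightarrow> real" where
  "logdet_series \<tau> x = (\<Sum>j. (-1) ^ j / real (Suc j) * \<tau> (Suc j) * x ^ Suc j)"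

lemma summable_bounded_power:
  fixes x :: real
  assumes "\<And>j. \<bar>a j\<bar> \<le> N" "\<bar>x\<bar> < 1"
  shows "summable (\<lambda>j. a j * x ^ j)"
proof (rule summable_comparison_test')
  show "summable (\<lambda>j. N * \<bar>x\<bar> ^ j)" using assms by (intro summable_mult summable_geometric) simp
  show "norm (a j * x ^ j) \<le> N * \<bar>x\<bar> ^ j" for j
    using assms(1)[of j] by (simp add: abs_mult power_abs mult_right_mono)
qed

text \<open>Termwise differentiation; for traces of powers the new series is the trace of
  \<open>A (1 + x A)^(-1)\<close>.\<close>

lemma logdet_series_has_derivative:
  assumes "\<And>j. \<bar>\<tau> j\<bar> \<le> N" "\<bar>x\<bar> < 1"
  shows "(logdet_series \<tau> has_real_derivative (\<Sum>j. (- x) ^ j * \<tau> (Suc j))) (at x)"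
proof -
  have eq: "(-1) ^ j / real (Suc j) * \<tau> (Suc j) * real (Suc j) * z ^ j = (-1) ^ j * \<tau> (Suc j) * z ^ j" for j z
    by simp
  have "((\<lambda>z. \<Sum>j. (-1) ^ j / real (Suc j) * \<tau> (Suc j) * z ^ Suc j) has_real_derivative
      (\<Sum>j. (-1) ^ j / real (Suc j) * \<tau> (Suc j) * real (Suc j) * x ^ j)) (at x)"
  proof (rule DERIV_power_series'[where R = 1])
    show "summable (\<lambda>j. (-1) ^ j / real (Suc j) * \<tau> (Suc j) * real (Suc j) * z ^ j)" if "z \<in> {-1<..<1}" for z
      unfolding eq using that assms(1) by (intro summable_bounded_power[of _ N]) (auto simp: abs_mult power_abs)
  qed (use assms in auto)
  then show ?thesis
    unfolding eq logdet_series_def[abs_def] by (simp add: power_minus[of x] mult_ac)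
qed

text \<open>The equation \<open>(1 + x A) y = (x + A) e_i\<close> is solved by
  \<open>x e_i + (1 - x^2) A (1 + x A)^(-1) e_i\<close>, with the inverse expanded as a Neumann
  series.\<close>

lemma resolvent_series:
  assumes A: "contractive B A" "finite B" and x: "\<bar>x\<bar> < 1"
    and y: "\<And>k. k \<in> B \<Longrightarrow> y k + x * (\<Sum>j\<in>B. A k j * y j) = x * mid k i + A k i"
    and i: "i \<in> B" and k: "k \<in> B"
  shows "y k = x * mid k i + (1 - x\<^sup>2) * (\<Sum>n. (- x) ^ n * mpow B A (Suc n) k i)"
proof -
  define S where "S k = (\<Sum>n. (- x) ^ n * mpow B A (Suc n) k i)" for k
  have smS: "(\<lambda>n. (- x) ^ n * mpow B A (Suc n) k i) sums S k" if "k \<in> B" for k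
  proof -
    have "summable (\<lambda>n. (- x) ^ n * mpow B A (Suc n) k i)"
      using summable_bounded_power[of "\<lambda>n. mpow B A (Suc n) k i" 1 "- x"] contractive_mpow_le_1[OF A that i] x
      by (simp add: mult.commute del: mpow.simps)
    then show ?thesis unfolding S_def by (rule summable_sums)
  qed
  have AS: "S k + x * (\<Sum>j\<in>B. A k j * S j) = A k i" if "k \<in> B" for k
  proof -
    have "(\<lambda>n. \<Sum>j\<in>B. A k j * ((- x) ^ n * mpow B A (Suc n) j i)) sums (\<Sum>j\<in>B. A k j * S j)"
      by (intro sums_sum sums_mult smS)
    moreover have "(\<Sum>j\<in>B. A k j * ((- x) ^ n * mpow B A (Suc n) j i)) = (- x) ^ n * mpow B A (Suc (Suc n)) k i" for n
      by (simp add: mmul_def[of B A "mmul B A _"] sum_distrib_left mult_ac)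
    ultimately have "(\<lambda>n. (- x) * ((- x) ^ n * mpow B A (Suc (Suc n)) k i)) sums ((- x) * (\<Sum>j\<in>B. A k j * S j))"
      by (intro sums_mult) simp
    then have "(\<lambda>n. (- x) ^ Suc n * mpow B A (Suc (Suc n)) k i) sums ((- x) * (\<Sum>j\<in>B. A k j * S j))"
      by (simp add: mult.assoc del: mpow.simps)
    then have "(\<lambda>n. (- x) ^ n * mpow B A (Suc n) k i) sums ((- x) * (\<Sum>j\<in>B. A k j * S j) + (- x) ^ 0 * mpow B A (Suc 0) k i)"
      by (subst (asm) sums_Suc_iff) (simp del: mpow.simps)
    then have "S k = (- x) * (\<Sum>j\<in>B. A k j * S j) + (- x) ^ 0 * mpow B A (Suc 0) k i"
      using smS[OF that] sums_unique2 by blast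
    then show ?thesis using A i that by (simp add: mmul_mid_right)
  qed
  \<comment> \<open>The difference of two solutions satisfies \<open>d = - x A d\<close>;
    contractivity and \<open>\<bar>x\<bar> < 1\<close> force it to vanish.\<close>
  define d where "d k = y k - (x * mid k i + (1 - x\<^sup>2) * S k)" for k
  have d: "d k = - x * (\<Sum>j\<in>B. A k j * d j)" if "k \<in> B" for k
  proof -
    have "(\<Sum>j\<in>B. A k j * d j) = (\<Sum>j\<in>B. A k j * y j) - x * mmul B A mid k i - (1 - x\<^sup>2) * (\<Sum>j\<in>B. A k j * S j)"
      by (simp add: d_def mmul_def right_diff_distrib distrib_left sum_subtractf sum.distrib sum_distrib_left mult_ac)
    then have "x * (\<Sum>j\<in>B. A k j * d j)
        = x * ((\<Sum>j\<in>B. A k j * y j) - x * A k i - (1 - x\<^sup>2) * (\<Sum>j\<in>B. A k j * S j))"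
      using A i by (simp only: mmul_mid_right)
    also have "\<dots> = x * (\<Sum>j\<in>B. A k j * y j) - x\<^sup>2 * A k i - (1 - x\<^sup>2) * (x * (\<Sum>j\<in>B. A k j * S j))"
      by (simp add: power2_eq_square algebra_simps)
    also have "x * (\<Sum>j\<in>B. A k j * S j) = A k i - S k" using AS[OF that] by simp
    also have "x * (\<Sum>j\<in>B. A k j * y j) = x * mid k i + A k i - y k" using y[OF that] by simp
    finally show ?thesis by (simp add: d_def algebra_simps)
  qed
  have "(\<Sum>k\<in>B. (d k)\<^sup>2) = x\<^sup>2 * (\<Sum>k\<in>B. (\<Sum>j\<in>B. A k j * d j)\<^sup>2)"
    unfolding sum_distrib_left by (rule sum.cong[OF refl], subst d) (auto simp: power_mult_distrib)
  also have "\<dots> \<le> x\<^sup>2 * (\<Sum>k\<in>B. (d k)\<^sup>2)"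
    using A(1) by (intro mult_left_mono) (auto simp: contractive_def)
  finally have "(1 - x\<^sup>2) * (\<Sum>k\<in>B. (d k)\<^sup>2) \<le> 0" by (simp add: algebra_simps)
  moreover have "x\<^sup>2 < 1" using x by (simp add: abs_square_less_1)
  ultimately have "(\<Sum>k\<in>B. (d k)\<^sup>2) = 0" by (simp add: mult_le_0_iff sum_nonneg order_antisym)
  then have "d k = 0" using A(2) k by (simp add: sum_nonneg_eq_0_iff)
  then show ?thesis by (simp add: d_def S_def)
qed

text \<open>Tilting a vector by \<open>exp (t/2 \<sigma>\<^sup>z)\<close> acts on the Majorana operators of the block \<open>B\<close> as a
  hyperbolic rotation, which turns the relation of the ground state into a linear equation for the
  tilted two-point function.\<close>

lemma tilted_two_point:
  fixes v :: "(int \<Rightarrow> bool) \<Rightarrow> real" and t :: real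
  assumes B: "B \<subseteq> box L"
    and rel: "\<And>k s. k \<in> box L \<Longrightarrow> s \<in> configs L \<Longrightarrow> maj_a L k v s + (\<Sum>j\<in>box L. A k j * maj_b L j v s) = 0"
  defines "w \<equiv> (\<lambda>s. exp (t / 2 * (\<Sum>i\<in>B. zval (s i))) * v s)"
  defines "r \<equiv> (\<lambda>k i. \<Sum>s\<in>configs L. maj_b L i w s * maj_a L k w s)"
  assumes k: "k \<in> B" and i: "i \<in> B"
  shows "cosh t * r k i + sinh t * (\<Sum>j\<in>B. A k j * r j i)
    = - (sinh t * mid k i + cosh t * A k i) * (\<Sum>s\<in>configs L. (w s)\<^sup>2)"
proof -
  let ?Z = "\<Sum>s\<in>configs L. (w s)\<^sup>2"
  define e where "e s = exp (t / 2 * (\<Sum>i\<in>B. zval (s i)))" for s :: "int \<Rightarrow> bool"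
  have finB: "finite B" using finite_subset[OF B] by simp
  have w_e: "w s = e s * v s" for s
    by (simp add: w_def e_def)
  have e_in: "e (flip j s) = exp (- t * zval (s j)) * e s" if "j \<in> B" for j s
  proof -
    have "(\<Sum>i\<in>B. zval (flip j s i)) = (\<Sum>i\<in>B. (if i = j then - 1 else 1) * zval (s i))"
      by (intro sum.cong) (auto simp: flip_apply)
    also have "\<dots> = (\<Sum>i\<in>B. zval (s i)) - 2 * zval (s j)"
      using finB that by (simp add: sum_sign_change)
    finally have flip: "(\<Sum>i\<in>B. zval (flip j s i)) = (\<Sum>i\<in>B. zval (s i)) - 2 * zval (s j)" .
    show ?thesis unfolding e_def flip exp_add[symmetric] by (simp add: algebra_simps)
  qed
  have e_out: "e (flip j s) = e s" if "j \<notin> B" for j s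
  proof -
    have "(\<Sum>i\<in>B. zval (flip j s i)) = (\<Sum>i\<in>B. zval (s i))"
      using that by (intro sum.cong) (auto simp: flip_apply)
    then show ?thesis by (simp add: e_def)
  qed
  \<comment> \<open>The flip of a site in \<open>B\<close> costs the factor
    \<open>exp (- t * zval (s j))\<close>; this identity writes its inverse as a hyperbolic rotation
    of the two Majorana operators.\<close>
  have cs: "cosh t + sinh t * zval b = exp (t * zval b)" for b
    by (simp add: zval_def cosh_plus_sinh cosh_minus_sinh)
  have a_in: "e s * maj_a L j v s = cosh t * maj_a L j w s + sinh t * maj_b L j w s" if "j \<in> B" for j s
  proof -
    have "cosh t * maj_a L j w s + sinh t * maj_b L j w s = (cosh t + sinh t * zval (s j)) * maj_a L j w s"
      by (simp add: maj_b_def algebra_simps)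
    also have "\<dots> = (exp (t * zval (s j)) * exp (- t * zval (s j))) * (e s * maj_a L j v s)"
      unfolding cs by (simp add: maj_a_def w_e e_in[OF that] mult_ac)
    finally show ?thesis by (simp add: exp_add[symmetric])
  qed
  have b_in: "e s * maj_b L j v s = cosh t * maj_b L j w s + sinh t * maj_a L j w s" if "j \<in> B" for j s
  proof -
    have "e s * maj_b L j v s = zval (s j) * (e s * maj_a L j v s)" by (simp add: maj_b_def)
    then show ?thesis unfolding a_in[OF that] by (simp add: maj_b_def algebra_simps)
  qed
  have b_out: "e s * maj_b L j v s = maj_b L j w s" if "j \<notin> B" for j s
    by (simp add: maj_b_def maj_a_def w_e e_out[OF that])
  have main: "cosh t * maj_a L k w s + sinh t * maj_b L k w s
      + (\<Sum>j\<in>B. A k j * (cosh t * maj_b L j w s + sinh t * maj_a L j w s)) + (\<Sum>j\<in>box L - B. A k j * maj_b L j w s) = 0"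
    if s: "s \<in> configs L" for s
  proof -
    have "0 = e s * (maj_a L k v s + (\<Sum>j\<in>box L. A k j * maj_b L j v s))"
      using rel[of k s] k B s by auto
    also have "\<dots> = e s * maj_a L k v s + (\<Sum>j\<in>box L. A k j * (e s * maj_b L j v s))"
      by (simp add: distrib_left sum_distrib_left mult_ac)
    also have "(\<Sum>j\<in>box L. A k j * (e s * maj_b L j v s))
        = (\<Sum>j\<in>box L - B. A k j * (e s * maj_b L j v s)) + (\<Sum>j\<in>B. A k j * (e s * maj_b L j v s))"
      by (rule sum.subset_diff[OF B finite_box])
    finally show ?thesis by (simp add: a_in[OF k] b_in b_out)
  qed
  have orth: "(\<Sum>s\<in>configs L. maj_b L i w s * maj_b L j w s) = mid i j * ?Z" if "j \<in> box L" for j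
    using maj_b_orthonormal[of i L j w] i B that by (auto simp: mid_def)
  \<comment> \<open>The relation is paired with \<open>maj_b L i w\<close>. Orthonormality removes
    the sites outside \<open>B\<close>, so the resulting system involves only the block.\<close>
  have "0 = (\<Sum>s\<in>configs L. maj_b L i w s * (cosh t * maj_a L k w s + sinh t * maj_b L k w s
      + (\<Sum>j\<in>B. A k j * (cosh t * maj_b L j w s + sinh t * maj_a L j w s)) + (\<Sum>j\<in>box L - B. A k j * maj_b L j w s)))"
    using main by simp
  also have "\<dots> = (\<Sum>s\<in>configs L. cosh t * (maj_b L i w s * maj_a L k w s) + sinh t * (maj_b L i w s * maj_b L k w s)
      + (\<Sum>j\<in>B. A k j * (cosh t * (maj_b L i w s * maj_b L j w s) + sinh t * (maj_b L i w s * maj_a L j w s)))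
      + (\<Sum>j\<in>box L - B. A k j * (maj_b L i w s * maj_b L j w s)))"
    by (intro sum.cong refl) (simp add: distrib_left sum_distrib_left mult_ac)
  also have "\<dots> = cosh t * r k i + sinh t * (\<Sum>s\<in>configs L. maj_b L i w s * maj_b L k w s)
      + (\<Sum>j\<in>B. A k j * (cosh t * (\<Sum>s\<in>configs L. maj_b L i w s * maj_b L j w s) + sinh t * r j i))
      + (\<Sum>j\<in>box L - B. A k j * (\<Sum>s\<in>configs L. maj_b L i w s * maj_b L j w s))"
    unfolding r_def sum.distrib sum_distrib_left[symmetric]
    by (simp only: sum.swap[of _ _ "configs L"] sum_distrib_left[symmetric] sum.distrib)
  also have "(\<Sum>j\<in>box L - B. A k j * (\<Sum>s\<in>configs L. maj_b L i w s * maj_b L j w s)) = 0"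
    using i by (intro sum.neutral) (auto simp: orth mid_def)
  also have "(\<Sum>j\<in>B. A k j * (cosh t * (\<Sum>s\<in>configs L. maj_b L i w s * maj_b L j w s) + sinh t * r j i))
      = (\<Sum>j\<in>B. cosh t * (A k j * mid i j) * ?Z + sinh t * (A k j * r j i))"
  proof (rule sum.cong[OF refl])
    fix j assume "j \<in> B"
    then have "j \<in> box L" using B by auto
    then show "A k j * (cosh t * (\<Sum>s\<in>configs L. maj_b L i w s * maj_b L j w s) + sinh t * r j i)
        = cosh t * (A k j * mid i j) * ?Z + sinh t * (A k j * r j i)"
      unfolding orth[OF \<open>j \<in> box L\<close>] by (simp add: algebra_simps)
  qed
  also have "\<dots> = cosh t * mmul B A mid k i * ?Z + sinh t * (\<Sum>j\<in>B. A k j * r j i)"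
    by (simp only: sum.distrib sum_distrib_left[symmetric] sum_distrib_right[symmetric] mmul_def mid_commute[of i])
  also have "mmul B A mid k i = A k i"
    using finB i by (rule mmul_mid_right)
  also have "(\<Sum>s\<in>configs L. maj_b L i w s * maj_b L k w s) = mid k i * ?Z"
    using orth[of k] k B by (auto simp: mid_commute)
  finally show ?thesis by (simp add: algebra_simps)
qed

definition trace_pow :: "int set \<Rightarrow> (int \<Rightarrow> int \<Rightarrow> real) \<Rightarrow> nat \<Rightarrow> real" where
  "trace_pow B A j = (\<Sum>k\<in>B. mpow B A j k k)"

lemma trace_pow_le:
  assumes "contractive B A" "finite B"
  shows "\<bar>trace_pow B A j\<bar> \<le> real (card B)"
proof -
  have "\<bar>trace_pow B A j\<bar> \<le> (\<Sum>k\<in>B. \<bar>mpow B A j k k\<bar>)"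
    unfolding trace_pow_def by (rule sum_abs)
  also have "\<dots> \<le> (\<Sum>k\<in>B. 1)"
    using contractive_mpow_le_1[OF assms] by (intro sum_mono) auto
  finally show ?thesis by simp
qed

lemma tanh_abs_less_1: "\<bar>tanh t\<bar> < (1::real)"
  using tanh_real_lt_1[of t] tanh_real_gt_neg1[of t] by simp

text \<open>Both \<open>ln Z\<close> and \<open>\<Phi>\<close> vanish at \<open>t = 0\<close> and
  have the same derivative. The derivative of \<open>ln Z\<close> is the tilted mean of the
  magnetisation, which is the trace of the tilted two-point function.\<close>

lemma generating_function:
  fixes v :: "(int \<Rightarrow> bool) \<Rightarrow> real"
  assumes B: "B \<subseteq> box L" and A: "contractive B A"
    and rel: "\<And>k s. k \<in> box L \<Longrightarrow> s \<in> configs L \<Longrightarrow> maj_a L k v s + (\<Sum>j\<in>box L. A k j * maj_b L j v s) = 0"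
    and unit: "(\<Sum>s\<in>configs L. (v s)\<^sup>2) = 1"
  shows "(\<Sum>s\<in>configs L. exp (t * (\<Sum>i\<in>B. zval (s i))) * (v s)\<^sup>2)
    = exp (real (card B) * ln (cosh t) + logdet_series (trace_pow B A) (tanh t))"
proof -
  define m where "m s = (\<Sum>i\<in>B. zval (s i))" for s :: "int \<Rightarrow> bool"
  define Z where "Z t = (\<Sum>s\<in>configs L. exp (t * m s) * (v s)\<^sup>2)" for t
  define \<Phi> where "\<Phi> t = real (card B) * ln (cosh t) + logdet_series (trace_pow B A) (tanh t)" for t
  have finB: "finite B" using finite_subset[OF B] by simp
  have Zpos: "Z t > 0" for t
  proof -
    have "\<exists>s\<in>configs L. v s \<noteq> 0"
    proof (rule ccontr)
      assume "\<not> ?thesis"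
      then have "(\<Sum>s\<in>configs L. (v s)\<^sup>2) = 0" by simp
      then show False using unit by simp
    qed
    then show ?thesis unfolding Z_def by (auto intro: sum_pos2)
  qed
  have dZ: "(Z has_real_derivative (\<Sum>s\<in>configs L. m s * exp (t * m s) * (v s)\<^sup>2)) (at t)" for t
    unfolding Z_def[abs_def] by (auto intro!: derivative_eq_intros sum.cong)
  have dlnZ: "(\<Sum>s\<in>configs L. m s * exp (t * m s) * (v s)\<^sup>2) / Z t
      = real (card B) * tanh t + (1 - (tanh t)\<^sup>2) * (\<Sum>n. (- tanh t) ^ n * trace_pow B A (Suc n))" for t
  proof -
    \<comment> \<open>Half of \<open>t\<close>, so that the squared entries of \<open>w\<close>
      carry the full weight.\<close>
    define w where "w s = exp (t / 2 * m s) * v s" for s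
    have w2: "(w s)\<^sup>2 = exp (t * m s) * (v s)\<^sup>2" for s
      by (simp add: w_def power_mult_distrib exp_double[symmetric])
    then have ZW: "(\<Sum>s\<in>configs L. (w s)\<^sup>2) = Z t" by (simp add: Z_def)
    \<comment> \<open>The sign makes \<open>y k k\<close> the tilted mean of \<open>zval\<close> at
      site \<open>k\<close>.\<close>
    define y where "y k i = - (\<Sum>s\<in>configs L. maj_b L i w s * maj_a L k w s) / Z t" for k i
    have "y k i + tanh t * (\<Sum>j\<in>B. A k j * y j i) = tanh t * mid k i + A k i" if "k \<in> B" "i \<in> B" for k i
    proof -
      let ?r = "\<lambda>k i. \<Sum>s\<in>configs L. maj_b L i w s * maj_a L k w s"
      have r: "cosh t * ?r k i + sinh t * (\<Sum>j\<in>B. A k j * ?r j i) = - (sinh t * mid k i + cosh t * A k i) * Z t"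
        using tilted_two_point[where v = v and A = A and t = t, OF B _ that] rel
        unfolding m_def[symmetric] w_def[symmetric] ZW by blast
      have ry: "?r k i = - y k i * Z t" for k i using Zpos[of t] by (simp add: y_def)
      have "(cosh t * y k i + sinh t * (\<Sum>j\<in>B. A k j * y j i)) * Z t = (sinh t * mid k i + cosh t * A k i) * Z t"
        using r unfolding ry by (simp add: sum_negf sum_distrib_right sum_distrib_left algebra_simps)
      then have "cosh t * y k i + sinh t * (\<Sum>j\<in>B. A k j * y j i) = sinh t * mid k i + cosh t * A k i"
        using Zpos[of t] by simp
      then show ?thesis by (simp add: tanh_def field_simps)
    qed
    then have y: "y k k = tanh t * mid k k + (1 - (tanh t)\<^sup>2) * (\<Sum>n. (- tanh t) ^ n * mpow B A (Suc n) k k)"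
      if "k \<in> B" for k
      using that by (intro resolvent_series[OF A finB tanh_abs_less_1, where y = "\<lambda>j. y j k"]) auto
    have sm: "summable (\<lambda>n. (- tanh t) ^ n * mpow B A (Suc n) k k)" if "k \<in> B" for k
      using summable_bounded_power[of "\<lambda>n. mpow B A (Suc n) k k" 1 "- tanh t"]
        contractive_mpow_le_1[OF A finB that that] tanh_abs_less_1[of t]
      by (simp add: mult.commute del: mpow.simps)
    have "(\<Sum>s\<in>configs L. m s * exp (t * m s) * (v s)\<^sup>2) = (\<Sum>s\<in>configs L. \<Sum>k\<in>B. zval (s k) * (w s)\<^sup>2)"
      by (simp add: w2 m_def sum_distrib_right mult.assoc)
    also have "\<dots> = (\<Sum>k\<in>B. \<Sum>s\<in>configs L. zval (s k) * (w s)\<^sup>2)" by (rule sum.swap)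
    also have "\<dots> = (\<Sum>k\<in>B. y k k * Z t)"
      using B Zpos[of t] sum_maj_b_maj_a[of _ L w] by (intro sum.cong) (auto simp: y_def)
    finally have "(\<Sum>s\<in>configs L. m s * exp (t * m s) * (v s)\<^sup>2) / Z t = (\<Sum>k\<in>B. y k k)"
      using Zpos[of t] by (simp add: sum_distrib_right[symmetric])
    also have "\<dots> = (\<Sum>k\<in>B. tanh t + (1 - (tanh t)\<^sup>2) * (\<Sum>n. (- tanh t) ^ n * mpow B A (Suc n) k k))"
      by (intro sum.cong refl) (simp add: y mid_def del: mpow.simps)
    also have "\<dots> = real (card B) * tanh t + (1 - (tanh t)\<^sup>2) * (\<Sum>k\<in>B. \<Sum>n. (- tanh t) ^ n * mpow B A (Suc n) k k)"
      by (simp add: sum.distrib sum_distrib_left)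
    also have "(\<Sum>k\<in>B. \<Sum>n. (- tanh t) ^ n * mpow B A (Suc n) k k) = (\<Sum>n. \<Sum>k\<in>B. (- tanh t) ^ n * mpow B A (Suc n) k k)"
      by (rule suminf_sum[symmetric]) (rule sm)
    finally show ?thesis by (simp add: trace_pow_def sum_distrib_left)
  qed
  have d\<Phi>: "(\<Phi> has_real_derivative (real (card B) * tanh t
      + (1 - (tanh t)\<^sup>2) * (\<Sum>n. (- tanh t) ^ n * trace_pow B A (Suc n)))) (at t)" for t
  proof -
    have "(logdet_series (trace_pow B A) has_real_derivative (\<Sum>n. (- tanh t) ^ n * trace_pow B A (Suc n))) (at (tanh t))"
      by (rule logdet_series_has_derivative[where N = "real (card B)"]) (auto simp: trace_pow_le[OF A finB] tanh_abs_less_1)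
    moreover have "(tanh has_real_derivative (1 - (tanh t)\<^sup>2)) (at t)"
      by (auto intro!: derivative_eq_intros)
    ultimately have "((\<lambda>t. logdet_series (trace_pow B A) (tanh t)) has_real_derivative
        (\<Sum>n. (- tanh t) ^ n * trace_pow B A (Suc n)) * (1 - (tanh t)\<^sup>2)) (at t)"
      by (rule DERIV_chain2)
    moreover have "((\<lambda>t. real (card B) * ln (cosh t)) has_real_derivative real (card B) * tanh t) (at t)"
      by (auto intro!: derivative_eq_intros simp: tanh_def cosh_real_pos)
    ultimately show ?thesis unfolding \<Phi>_def[abs_def]
      by (auto intro!: derivative_eq_intros simp: tanh_def)
  qed
  have "((\<lambda>t. ln (Z t) - \<Phi> t) has_real_derivative 0) (at t)" for t
    using dZ[of t] d\<Phi>[of t] Zpos[of t] dlnZ[of t] by (auto intro!: derivative_eq_intros)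
  then have "ln (Z t) - \<Phi> t = ln (Z 0) - \<Phi> 0"
    by (intro DERIV_isconst_all) auto
  also have "\<dots> = 0" using unit by (simp add: Z_def \<Phi>_def logdet_series_def)
  finally have "Z t = exp (\<Phi> t)" using Zpos[of t] by (metis eq_iff_diff_eq_0 exp_ln)
  then show ?thesis by (simp add: Z_def \<Phi>_def m_def)
qed

section \<open>Infinite volume and Toeplitz traces\<close>

lemma mpow_translate:
  fixes T :: "int \<Rightarrow> int \<Rightarrow> real"
  assumes "\<And>i j. T (i + a) (j + a) = T i j"
  shows "mpow ((\<lambda>i. i + a) ` I) T k (i + a) (j + a) = mpow I T k i j"
proof (induction k arbitrary: i j)
  case 0
  then show ?case by (simp add: mid_def)
next
  case (Suc k)
  have "mpow ((\<lambda>i. i + a) ` I) T (Suc k) (i + a) (j + a)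
      = (\<Sum>l\<in>I. T (i + a) (l + a) * mpow ((\<lambda>i. i + a) ` I) T k (l + a) (j + a))"
    by (simp add: mmul_def sum.reindex)
  then show ?case using Suc assms by (simp add: mmul_def)
qed

lemma mpow_tendsto:
  assumes "\<And>i j. ((\<lambda>L. A L i j) \<longlongrightarrow> T i j) F"
  shows "((\<lambda>L. mpow B (A L) k i j) \<longlongrightarrow> mpow B T k i j) F"
proof (induction k arbitrary: i j)
  case (Suc k)
  then show ?case using assms by (auto simp: mmul_def intro!: tendsto_intros)
qed simp

lemma eventually_prod_sndI:
  assumes "eventually P F"
  shows "eventually (\<lambda>(k, n). P n) (G \<times>\<^sub>F F)"
  using assms unfolding eventually_prod_filter by (intro exI[of _ "\<lambda>_. True"] exI[of _ P]) auto

text \<open>Stated for a general filter: it serves growing boxes, growing blocks and growing finite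
  sets of integers.\<close>

lemma tannery_uniform:
  fixes a :: "nat \<Rightarrow> 'b \<Rightarrow> real"
  assumes "\<And>k. ((\<lambda>n. a k n) \<longlongrightarrow> b k) F" "eventually (\<lambda>n. \<forall>k. \<bar>a k n\<bar> \<le> M k) F" "summable M" "F \<noteq> bot"
  shows "((\<lambda>n. \<Sum>k. a k n) \<longlongrightarrow> (\<Sum>k. b k)) F"
proof -
  have "eventually (\<lambda>(k, n). norm (a k n) \<le> M k) (at_top \<times>\<^sub>F F)"
    using eventually_prod_sndI[OF assms(2)] by (rule eventually_mono) auto
  from tannerys_theorem[OF assms(1) this assms(3,4)] show ?thesis by blast
qed

text \<open>The uniform bound on the coefficients supplies a geometric majorant. It is used for the
  volume limit with a fixed block, and again for the averaged traces of growing blocks.\<close>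

lemma logdet_series_tendsto:
  assumes "\<And>j. ((\<lambda>L. \<tau> L j) \<longlongrightarrow> \<tau>' j) F" "eventually (\<lambda>L. \<forall>j. \<bar>\<tau> L j\<bar> \<le> N) F" "\<bar>x\<bar> < 1" "F \<noteq> bot"
  shows "((\<lambda>L. logdet_series (\<tau> L) x) \<longlongrightarrow> logdet_series \<tau>' x) F"
  unfolding logdet_series_def
proof (rule tannery_uniform)
  show "((\<lambda>L. (-1) ^ j / real (Suc j) * \<tau> L (Suc j) * x ^ Suc j) \<longlongrightarrow> (-1) ^ j / real (Suc j) * \<tau>' (Suc j) * x ^ Suc j) F" for j
    by (intro tendsto_intros assms)
  show "summable (\<lambda>j. N * \<bar>x\<bar> ^ Suc j)"
    using assms(3) by (intro summable_mult) (simp add: summable_Suc_iff summable_geometric)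
  have "\<bar>(-1) ^ j / real (Suc j) * t * x ^ Suc j\<bar> \<le> N * \<bar>x\<bar> ^ Suc j" if "\<bar>t\<bar> \<le> N" for t j
  proof -
    have "\<bar>(-1) ^ j / real (Suc j) * t\<bar> \<le> 1 * \<bar>t\<bar>"
      unfolding abs_mult by (intro mult_right_mono) (auto simp: power_abs)
    also have "\<dots> \<le> N" using that by simp
    finally show ?thesis
      unfolding abs_mult[of _ "x ^ Suc j"] power_abs by (intro mult_right_mono) auto
  qed
  then show "eventually (\<lambda>L. \<forall>j. \<bar>(-1) ^ j / real (Suc j) * \<tau> L (Suc j) * x ^ Suc j\<bar> \<le> N * \<bar>x\<bar> ^ Suc j) F"
    using eventually_mono[OF assms(2)] by (smt (verit, best))
qed fact

lemma summable_on_int_geometric: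
  fixes q :: real
  assumes "0 \<le> q" "q < 1"
  shows "(\<lambda>d::int. q ^ nat \<bar>d\<bar>) summable_on UNIV"
proof -
  have g: "(\<lambda>n. q ^ n) summable_on UNIV"
    using assms by (intro summable_nonneg_imp_summable_on) (auto simp: summable_geometric)
  have "(\<lambda>d::int. q ^ nat \<bar>d\<bar>) summable_on (int ` UNIV)"
    by (subst summable_on_reindex) (auto simp: o_def g)
  \<comment> \<open>The shift by one keeps 0 out of the second half.\<close>
  moreover have "(\<lambda>d::int. q ^ nat \<bar>d\<bar>) summable_on ((\<lambda>n. - int n - 1) ` UNIV)"
  proof (subst summable_on_reindex)
    have "nat \<bar>- int n - 1\<bar> = Suc n" for n by simp
    then show "((\<lambda>d. q ^ nat \<bar>d\<bar>) \<circ> (\<lambda>n. - int n - 1)) summable_on UNIV"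
      using summable_on_cmult_right[OF g, of q] by (simp add: o_def)
  qed (auto simp: inj_on_def)
  moreover have "int ` UNIV \<inter> (\<lambda>n. - int n - 1) ` UNIV = {}" by auto
  ultimately have "(\<lambda>d::int. q ^ nat \<bar>d\<bar>) summable_on (int ` UNIV \<union> (\<lambda>n. - int n - 1) ` UNIV)"
    by (rule summable_on_Un_disjoint)
  moreover have "d \<in> int ` UNIV \<union> (\<lambda>n. - int n - 1) ` UNIV" for d :: int
  proof (cases "d \<ge> 0")
    case True
    then show ?thesis by (auto intro: image_eqI[of _ _ "nat d"])
  next
    case False
    then show ?thesis by (auto intro: image_eqI[of _ _ "nat (- d - 1)"])
  qed
  then have "int ` UNIV \<union> (\<lambda>n. - int n - 1) ` UNIV = UNIV" by blast
  ultimately show ?thesis by simp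
qed

section \<open>Averaged traces of powers of Toeplitz blocks\<close>

locale summable_symbol =
  fixes f :: "int \<Rightarrow> real"
  assumes summable: "(\<lambda>d. \<bar>f d\<bar>) summable_on UNIV"
begin

definition T :: "int \<Rightarrow> int \<Rightarrow> real" where
  "T i j = f (i - j)"

definition b :: real where
  "b = infsum (\<lambda>d. \<bar>f d\<bar>) UNIV"

lemma b_nonneg: "0 \<le> b"
  unfolding b_def by (intro infsum_nonneg) simp

lemma mpow_T_le:
  assumes "finite I"
  shows "\<bar>mpow I T k i j\<bar> \<le> b ^ k"
proof (induction k arbitrary: i)
  case 0
  then show ?case by (simp add: mid_def)
next
  case (Suc k)
  have "\<bar>mpow I T (Suc k) i j\<bar> \<le> (\<Sum>l\<in>I. \<bar>T i l * mpow I T k l j\<bar>)"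
    by (simp add: mmul_def)
  also have "\<dots> \<le> (\<Sum>l\<in>I. \<bar>T i l\<bar> * b ^ k)"
    unfolding abs_mult by (intro sum_mono mult_left_mono Suc.IH) auto
  also have "\<dots> = (\<Sum>d\<in>(\<lambda>l. i - l) ` I. \<bar>f d\<bar>) * b ^ k"
    by (subst sum.reindex) (auto simp: inj_on_def T_def sum_distrib_right)
  also have "\<dots> \<le> b * b ^ k"
    unfolding b_def using b_nonneg[unfolded b_def] assms
    by (intro mult_right_mono finite_sum_le_infsum summable) auto
  finally show ?case by simp
qed

text \<open>Entries of powers of the compressions converge to those of the power on the full
  lattice: induction on the power, with dominated convergence in the intermediate index.\<close>

lemma mpow_T_convergent:
  "\<exists>c. \<forall>i j. ((\<lambda>I. mpow I T k i j) \<longlongrightarrow> c i j) (finite_subsets_at_top UNIV)"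
proof (induction k)
  case 0
  then show ?case by (intro exI[of _ mid]) auto
next
  case (Suc k)
  then obtain c where c: "\<And>i j. ((\<lambda>I. mpow I T k i j) \<longlongrightarrow> c i j) (finite_subsets_at_top UNIV)"
    by blast
  have fin: "eventually finite (finite_subsets_at_top (UNIV :: int set))"
    by (auto simp: eventually_finite_subsets_at_top)
  have "((\<lambda>I. mpow I T (Suc k) i j) \<longlongrightarrow> (\<Sum>n. T i (int_decode n) * c (int_decode n) j))
      (finite_subsets_at_top UNIV)" for i j
  proof -
    \<comment> \<open>The sum over \<open>I\<close> becomes a series over naturals with terms
      switched off outside \<open>I\<close>, so that Tannery's theorem applies.\<close>
    define a where "a n I = (if int_decode n \<in> I then T i (int_decode n) * mpow I T k (int_decode n) j else 0)" for n I
    have "((\<lambda>I. \<Sum>n. a n I) \<longlongrightarrow> (\<Sum>n. T i (int_decode n) * c (int_decode n) j)) (finite_subsets_at_top UNIV)"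
    proof (rule tannery_uniform)
      show "((\<lambda>I. a n I) \<longlongrightarrow> T i (int_decode n) * c (int_decode n) j) (finite_subsets_at_top UNIV)" for n
      proof (rule Lim_transform_eventually)
        show "((\<lambda>I. T i (int_decode n) * mpow I T k (int_decode n) j) \<longlongrightarrow> T i (int_decode n) * c (int_decode n) j)
            (finite_subsets_at_top UNIV)"
          by (intro tendsto_intros c)
        show "\<forall>\<^sub>F I in finite_subsets_at_top UNIV. T i (int_decode n) * mpow I T k (int_decode n) j = a n I"
          by (auto simp: eventually_finite_subsets_at_top a_def intro!: exI[of _ "{int_decode n}"])
      qed
      show "\<forall>\<^sub>F I in finite_subsets_at_top UNIV. \<forall>n. \<bar>a n I\<bar> \<le> \<bar>f (i - int_decode n)\<bar> * b ^ k"
      proof (rule eventually_mono[OF fin], intro allI)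
        fix I :: "int set" and n assume "finite I"
        then show "\<bar>a n I\<bar> \<le> \<bar>f (i - int_decode n)\<bar> * b ^ k"
          using mpow_T_le[of I k "int_decode n" j] b_nonneg
          by (auto simp: a_def abs_mult T_def intro: mult_left_mono)
      qed
      have "bij (\<lambda>n. i - int_decode n)"
        by (rule bij_betw_byWitness[of _ "\<lambda>d. int_encode (i - d)"]) auto
      then have "(\<lambda>n. \<bar>f (i - int_decode n)\<bar>) summable_on UNIV"
        using summable_on_reindex_bij_betw[of "\<lambda>n. i - int_decode n" UNIV UNIV "\<lambda>d. \<bar>f d\<bar>"] summable by simp
      then show "summable (\<lambda>n. \<bar>f (i - int_decode n)\<bar> * b ^ k)"
        by (intro summable_mult2 summable_on_imp_summable)
    qed simp
    moreover have "\<forall>\<^sub>F I in finite_subsets_at_top UNIV. (\<Sum>n. a n I) = mpow I T (Suc k) i j"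
    proof (rule eventually_mono[OF fin])
      fix I :: "int set" assume I: "finite I"
      have "(\<Sum>n. a n I) = (\<Sum>n\<in>int_encode ` I. a n I)"
      proof (rule suminf_finite)
        show "finite (int_encode ` I)" using I by simp
        show "a n I = 0" if "n \<notin> int_encode ` I" for n
          using that by (metis a_def imageI int_decode_inverse)
      qed
      also have "\<dots> = (\<Sum>l\<in>I. T i l * mpow I T k l j)"
        by (subst sum.reindex) (auto simp: inj_on_def a_def int_encode_eq)
      finally show "(\<Sum>n. a n I) = mpow I T (Suc k) i j" by (simp add: mmul_def)
    qed
    ultimately show ?thesis by (rule Lim_transform_eventually)
  qed
  then show ?case
    by (intro exI[of _ "\<lambda>i j. \<Sum>n. T i (int_decode n) * c (int_decode n) j"]) blast
qed

text \<open>By translation invariance, the diagonal entry at \<open>j\<close> is the entry at the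
  origin for the shifted block. It is close to its full-lattice limit unless \<open>j\<close> is
  near an end of the block, and the boundary sites disappear in the average.\<close>

lemma trace_pow_average_convergent:
  "convergent (\<lambda>n. trace_pow {1..int n} T k / real n)"
proof -
  obtain c' where "\<And>i j. ((\<lambda>I. mpow I T k i j) \<longlongrightarrow> c' i j) (finite_subsets_at_top UNIV)"
    using mpow_T_convergent by blast
  then obtain c where c: "((\<lambda>I. mpow I T k 0 0) \<longlongrightarrow> c) (finite_subsets_at_top UNIV)" by blast
  have shift: "mpow {1..int n} T k j j = mpow {1 - j..int n - j} T k 0 0" for n j
  proof -
    have "(\<lambda>i. i + j) ` {1 - j..int n - j} = {1..int n}"
    proof -
      have "x \<in> (\<lambda>i. i + j) ` {1 - j..int n - j}" if "x \<in> {1..int n}" for x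
        using that by (intro image_eqI[of _ _ "x - j"]) auto
      then show ?thesis by auto
    qed
    then show ?thesis
      using mpow_translate[of T j "{1 - j..int n - j}" k 0 0] by (simp add: T_def)
  qed
  define K where "K = b ^ k + \<bar>c\<bar>"
  have K: "\<bar>mpow I T k 0 0 - c\<bar> \<le> K" if "finite I" for I
    using mpow_T_le[OF that, of k 0 0] by (simp add: K_def)
  have "(\<lambda>n. trace_pow {1..int n} T k / real n) \<longlonglongrightarrow> c"
  proof (rule LIMSEQ_I)
    fix e :: real assume e: "e > 0"
    then have "\<forall>\<^sub>F I in finite_subsets_at_top UNIV. dist (mpow I T k 0 0) c < e / 2"
      using c tendstoD[of _ c _ "e / 2"] by simp
    then obtain J0 where J0: "finite J0" "\<And>I. finite I \<Longrightarrow> J0 \<subseteq> I \<Longrightarrow> dist (mpow I T k 0 0) c < e / 2"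
      unfolding eventually_finite_subsets_at_top by auto
    define D where "D = nat (\<Sum>x\<in>J0. \<bar>x\<bar>)"
    have D: "J0 \<subseteq> {- int D..int D}"
    proof
      fix x assume "x \<in> J0"
      then have "\<bar>x\<bar> \<le> (\<Sum>x\<in>J0. \<bar>x\<bar>)" using J0(1) by (intro member_le_sum) auto
      then show "x \<in> {- int D..int D}" by (auto simp: D_def abs_le_iff)
    qed
    \<comment> \<open>Exactly the sites \<open>j\<close> for which the shifted block
      \<open>{1 - j..int n - j}\<close> contains \<open>{- int D..int D}\<close>; at most
      \<open>D\<close> sites at each end are lost.\<close>
    define S where "S n = {1..int n} \<inter> {int D <.. int n - int D}" for n
    have bound: "\<bar>trace_pow {1..int n} T k / real n - c\<bar> \<le> e / 2 + 2 * real D * K / real n" if n: "n > 0" for n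
    proof -
      have cardS: "card ({1..int n} - S n) \<le> 2 * D"
      proof -
        have "{1..int n} - S n \<subseteq> {1..int D} \<union> {int n - int D <.. int n}" by (auto simp: S_def)
        then have "card ({1..int n} - S n) \<le> card ({1..int D} \<union> {int n - int D <.. int n})"
          by (intro card_mono) auto
        also have "\<dots> \<le> card {1..int D} + card {int n - int D <.. int n}" by (rule card_Un_le)
        finally show ?thesis by simp
      qed
      have S_le: "card (S n) \<le> n"
        using card_mono[of "{1..int n}" "S n"] by (auto simp: S_def)
      have "\<bar>\<Sum>j\<in>{1..int n}. mpow {1..int n} T k j j - c\<bar> \<le> (\<Sum>j\<in>{1..int n}. \<bar>mpow {1..int n} T k j j - c\<bar>)"
        by (rule sum_abs)
      also have "\<dots> = (\<Sum>j\<in>{1..int n} - S n. \<bar>mpow {1..int n} T k j j - c\<bar>) + (\<Sum>j\<in>S n. \<bar>mpow {1..int n} T k j j - c\<bar>)"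
        by (rule sum.subset_diff) (auto simp: S_def)
      also have "\<dots> \<le> real (card ({1..int n} - S n)) * K + real (card (S n)) * (e / 2)"
      proof (intro add_mono sum_bounded_above)
        show "\<bar>mpow {1..int n} T k j j - c\<bar> \<le> K" for j
          unfolding shift by (intro K) simp
        fix j assume "j \<in> S n"
        then have "J0 \<subseteq> {1 - j..int n - j}" using D by (auto simp: S_def)
        then show "\<bar>mpow {1..int n} T k j j - c\<bar> \<le> e / 2"
          unfolding shift using J0(2)[of "{1 - j..int n - j}"] by (simp add: dist_real_def)
      qed
      also have "\<dots> \<le> real (2 * D) * K + real n * (e / 2)"
        using cardS S_le e b_nonneg by (intro add_mono mult_right_mono) (auto simp: K_def)
      finally have "\<bar>trace_pow {1..int n} T k - real n * c\<bar> \<le> real (2 * D) * K + real n * (e / 2)"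
        by (simp add: trace_pow_def sum_subtractf)
      moreover have "trace_pow {1..int n} T k / real n - c = (trace_pow {1..int n} T k - real n * c) / real n"
        using n by (simp add: field_simps)
      ultimately show ?thesis using n by (simp add: abs_divide field_simps)
    qed
    have "(\<lambda>n. e / 2 + 2 * real D * K / real n) \<longlonglongrightarrow> e / 2 + 0"
      by (intro tendsto_intros lim_const_over_n)
    then have "eventually (\<lambda>n. e / 2 + 2 * real D * K / real n < e) sequentially"
      by (rule order_tendstoD(2)) (use e in simp)
    then obtain N where N: "\<And>n. n \<ge> N \<Longrightarrow> e / 2 + 2 * real D * K / real n < e"
      by (auto simp: eventually_sequentially)
    show "\<exists>N. \<forall>n\<ge>N. norm (trace_pow {1..int n} T k / real n - c) < e"
    proof (intro exI[of _ "Suc N"] allI impI)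
      fix n assume "n \<ge> Suc N"
      then show "norm (trace_pow {1..int n} T k / real n - c) < e"
        using bound[of n] N[of n] by simp
    qed
  qed
  then show ?thesis by (rule convergentI)
qed

end

section \<open>Bulk limit of the polar factor\<close>

context ising_couplings
begin

text \<open>Powers under convolution of the symbol that \<open>X\<close> has away from the left
  end.\<close>

fun bulk_pow :: "nat \<Rightarrow> int \<Rightarrow> real" where
  "bulk_pow 0 d = (if d = 0 then 1 else 0)"
| "bulk_pow (Suc k) d = (1 - \<mu>\<^sup>2 - \<nu>\<^sup>2) * bulk_pow k d - \<mu> * \<nu> * (bulk_pow k (d - 1) + bulk_pow k (d + 1))"

definition bulk_R :: "int \<Rightarrow> real" where
  "bulk_R d = (\<Sum>k. inv_sqrt_coeff k * bulk_pow k d)"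

text \<open>The shift comes from \<open>R M^T\<close>: its entry at \<open>i\<close>,
  \<open>j\<close> involves \<open>R\<close> at \<open>j\<close> and at \<open>j + 1\<close>, that
  is, at the differences \<open>d\<close> and \<open>d - 1\<close>.\<close>

definition bulk_A :: "int \<Rightarrow> real" where
  "bulk_A d = \<mu> * bulk_R d + \<nu> * bulk_R (d - 1)"

text \<open>Each factor \<open>X\<close> moves by at most one site, so \<open>k\<close> steps from
  \<open>i\<close> never see the ends of the box.\<close>

lemma mpow_X_bulk:
  assumes "\<bar>i\<bar> + int k < int L" "j \<in> box L"
  shows "mpow (box L) (X L) k i j = bulk_pow k (i - j)"
  using assms(1)
proof (induction k arbitrary: i)
  case 0
  then show ?case by (simp add: mid_def)
next
  case (Suc k)
  have "mpow (box L) (X L) (Suc k) i j = (\<Sum>l\<in>box L. X L i l * mpow (box L) (X L) k l j)"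
    by (simp add: mmul_def)
  also have "\<dots> = (\<Sum>l\<in>{i - 1, i, i + 1}. X L i l * mpow (box L) (X L) k l j)"
    using Suc.prems by (intro sum.mono_neutral_right) (auto simp: X_def box_def)
  also have "\<dots> = (\<Sum>l\<in>{i - 1, i, i + 1}. X L i l * bulk_pow k (l - j))"
    using Suc.prems by (intro sum.cong refl) (auto simp: Suc.IH)
  also have "\<dots> = bulk_pow (Suc k) (i - j)"
    using Suc.prems by (simp add: X_def algebra_simps)
  finally show ?case .
qed

lemma bulk_pow_le: "\<bar>bulk_pow k d\<bar> \<le> \<theta> ^ k"
proof -
  \<comment> \<open>Any box large enough for the bulk formula will do; the finite-volume bound then
    carries over.\<close>
  define L where "L = nat \<bar>d\<bar> + k + 1"
  have "mpow (box L) (X L) k d 0 = bulk_pow k (d - 0)"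
    by (rule mpow_X_bulk) (auto simp: L_def box_def)
  moreover have "d \<in> box L" "0 \<in> box L" by (auto simp: L_def box_def)
  ultimately show ?thesis using ssm.mpow_le[of d L 0 k] by simp
qed

lemma bulk_pow_eq_0: "\<bar>d\<bar> > int k \<Longrightarrow> bulk_pow k d = 0"
  by (induction k arbitrary: d) auto

text \<open>Powers below \<open>\<bar>d\<bar>\<close> have no entry at distance \<open>d\<close>, so
  only a geometric tail remains and the kernel decays exponentially.\<close>

lemma bulk_R_le: "\<bar>bulk_R d\<bar> \<le> \<theta> ^ nat \<bar>d\<bar> / (1 - \<theta>)"
proof -
  define n where "n = nat \<bar>d\<bar>"
  have le: "\<bar>inv_sqrt_coeff k * bulk_pow k d\<bar> \<le> \<theta> ^ k" for k
    using mult_mono[OF ssm.abs_inv_sqrt_coeff_le_1[of k] bulk_pow_le[of k d]] by (simp add: abs_mult)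
  have g: "summable (\<lambda>k. \<theta> ^ k)" using theta_nonneg theta_less_1 by (simp add: summable_geometric)
  have "summable (\<lambda>k. inv_sqrt_coeff k * bulk_pow k d)"
    by (rule summable_comparison_test'[OF g]) (use le in auto)
  then have "bulk_R d = (\<Sum>k. inv_sqrt_coeff (k + n) * bulk_pow (k + n) d) + (\<Sum>k<n. inv_sqrt_coeff k * bulk_pow k d)"
    unfolding bulk_R_def by (rule suminf_split_initial_segment)
  also have "(\<Sum>k<n. inv_sqrt_coeff k * bulk_pow k d) = 0"
    by (intro sum.neutral) (auto simp: n_def bulk_pow_eq_0)
  finally have "bulk_R d = (\<Sum>k. inv_sqrt_coeff (k + n) * bulk_pow (k + n) d)" by simp
  moreover have "norm (\<Sum>k. inv_sqrt_coeff (k + n) * bulk_pow (k + n) d) \<le> (\<Sum>k. \<theta> ^ n * \<theta> ^ k)"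
  proof (rule norm_suminf_le)
    show "norm (inv_sqrt_coeff (k + n) * bulk_pow (k + n) d) \<le> \<theta> ^ n * \<theta> ^ k" for k
      using le[of "k + n"] by (simp add: power_add mult.commute)
    show "summable (\<lambda>k. \<theta> ^ n * \<theta> ^ k)" using g by (rule summable_mult)
  qed
  moreover have "(\<Sum>k. \<theta> ^ n * \<theta> ^ k) = \<theta> ^ n / (1 - \<theta>)"
    using g theta_nonneg theta_less_1 by (simp add: suminf_mult suminf_geometric)
  ultimately show ?thesis by (simp add: n_def)
qed

lemma bulk_A_summable: "(\<lambda>d. \<bar>bulk_A d\<bar>) summable_on UNIV"
proof -
  let ?g = "\<lambda>d::int. \<theta> ^ nat \<bar>d\<bar>"
  have g: "?g summable_on UNIV" using theta_nonneg theta_less_1 by (rule summable_on_int_geometric)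
  have "bij (\<lambda>d::int. d - 1)" by (rule bij_betw_byWitness[of _ "\<lambda>d. d + 1"]) auto
  then have g': "(\<lambda>d. ?g (d - 1)) summable_on UNIV"
    using summable_on_reindex_bij_betw[of "\<lambda>d::int. d - 1" UNIV UNIV ?g] g by simp
  have "(\<lambda>d. \<bar>\<mu>\<bar> / (1 - \<theta>) * ?g d + \<bar>\<nu>\<bar> / (1 - \<theta>) * ?g (d - 1)) summable_on UNIV"
    by (intro summable_on_add summable_on_cmult_right g g')
  then show ?thesis
  proof (rule summable_on_comparison_test)
    fix d
    have "\<bar>bulk_A d\<bar> \<le> \<bar>\<mu>\<bar> * \<bar>bulk_R d\<bar> + \<bar>\<nu>\<bar> * \<bar>bulk_R (d - 1)\<bar>"
      unfolding bulk_A_def by (metis abs_mult abs_triangle_ineq)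
    also have "\<dots> \<le> \<bar>\<mu>\<bar> * (?g d / (1 - \<theta>)) + \<bar>\<nu>\<bar> * (?g (d - 1) / (1 - \<theta>))"
      by (intro add_mono mult_left_mono bulk_R_le) auto
    finally show "\<bar>bulk_A d\<bar> \<le> \<bar>\<mu>\<bar> / (1 - \<theta>) * ?g d + \<bar>\<nu>\<bar> / (1 - \<theta>) * ?g (d - 1)" by simp
  qed auto
qed

text \<open>Each term of the series is eventually equal to its bulk value, and
  \<open>\<theta> ^ k\<close> is a majorant uniform in the volume.\<close>

lemma R_tendsto: "(\<lambda>L. ssm.R L i j) \<longlonglongrightarrow> bulk_R (i - j)"
  unfolding ssm.R_def bulk_R_def
proof (rule tannery_uniform)
  have big: "eventually (\<lambda>L. int L > m) sequentially" for m
    using eventually_gt_at_top[of "nat \<bar>m\<bar>"] by (rule eventually_mono) auto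
  show "(\<lambda>L. inv_sqrt_coeff k * mpow (box L) (X L) k i j) \<longlonglongrightarrow> inv_sqrt_coeff k * bulk_pow k (i - j)" for k
  proof (rule tendsto_eventually)
    show "\<forall>\<^sub>F L in sequentially. inv_sqrt_coeff k * mpow (box L) (X L) k i j = inv_sqrt_coeff k * bulk_pow k (i - j)"
      using big[of "\<bar>i\<bar> + \<bar>j\<bar> + int k"] by (rule eventually_mono) (subst mpow_X_bulk, auto simp: box_def)
  qed
  show "\<forall>\<^sub>F L in sequentially. \<forall>k. \<bar>inv_sqrt_coeff k * mpow (box L) (X L) k i j\<bar> \<le> \<theta> ^ k"
    using big[of "\<bar>i\<bar> + \<bar>j\<bar>"]
  proof (rule eventually_mono, intro allI)
    fix L k assume "int L > \<bar>i\<bar> + \<bar>j\<bar>"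
    then have "i \<in> box L" "j \<in> box L" by (auto simp: box_def)
    then show "\<bar>inv_sqrt_coeff k * mpow (box L) (X L) k i j\<bar> \<le> \<theta> ^ k"
      using mult_mono[OF ssm.abs_inv_sqrt_coeff_le_1[of k] ssm.mpow_le[of i L j k]] by (simp add: abs_mult)
  qed
  show "summable (\<lambda>k. \<theta> ^ k)" using theta_nonneg theta_less_1 by (simp add: summable_geometric)
qed simp

lemma A_tendsto: "(\<lambda>L. A L i j) \<longlonglongrightarrow> bulk_A (i - j)"
proof (rule Lim_transform_eventually)
  show "(\<lambda>L. \<mu> * ssm.R L i j + \<nu> * ssm.R L i (j + 1)) \<longlonglongrightarrow> bulk_A (i - j)"
    unfolding bulk_A_def using R_tendsto[of i "j + 1"] by (intro tendsto_intros R_tendsto) (simp add: algebra_simps)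
  show "\<forall>\<^sub>F L in sequentially. \<mu> * ssm.R L i j + \<nu> * ssm.R L i (j + 1) = A L i j"
    using eventually_gt_at_top[of "nat \<bar>j\<bar>"] by (rule eventually_mono) (subst A_eq, auto simp: box_def)
qed

sublocale bulk: summable_symbol bulk_A
  by unfold_locales (rule bulk_A_summable)

end

section \<open>Analyticity and the limit\<close>

lemma logdet_series_sums:
  assumes "\<And>j. \<bar>\<tau> j\<bar> \<le> N" "\<bar>x\<bar> < 1"
  shows "(\<lambda>j. (-1) ^ j / real (Suc j) * \<tau> (Suc j) * x ^ Suc j) sums logdet_series \<tau> x"
proof -
  have "\<bar>(-1) ^ j / real (Suc j) * \<tau> (Suc j) * x\<bar> \<le> N" for j
  proof -
    have "\<bar>(-1) ^ j / real (Suc j) * \<tau> (Suc j) * x\<bar> = \<bar>x\<bar> / real (Suc j) * \<bar>\<tau> (Suc j)\<bar>"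
      by (simp add: abs_mult power_abs)
    also have "\<dots> \<le> 1 * \<bar>\<tau> (Suc j)\<bar>"
      using assms(2) by (intro mult_right_mono) (auto simp: field_simps)
    finally show ?thesis using assms(1)[of "Suc j"] by simp
  qed
  then have "summable (\<lambda>j. (-1) ^ j / real (Suc j) * \<tau> (Suc j) * x * x ^ j)"
    using assms(2) by (rule summable_bounded_power)
  then show ?thesis unfolding logdet_series_def by (intro summable_sums) (simp add: mult.assoc)
qed

lemma logdet_series_divide:
  assumes "\<And>j. \<bar>\<tau> j\<bar> \<le> N" "\<bar>x\<bar> < 1"
  shows "logdet_series (\<lambda>j. \<tau> j / r) x = logdet_series \<tau> x / r"
  using sums_divide[OF logdet_series_sums[of \<tau> N x], of r] assms
  unfolding logdet_series_def by (auto simp: sums_iff)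

lemma logdet_series_holomorphic:
  assumes "\<And>j. \<bar>\<tau> j\<bar> \<le> N"
  obtains g where "g holomorphic_on ball 0 1" "\<And>x. \<bar>x\<bar> < 1 \<Longrightarrow> g (of_real x) = complex_of_real (logdet_series \<tau> x)"
proof -
  define a where "a j = (-1) ^ j / real (Suc j) * \<tau> (Suc j)" for j
  \<comment> \<open>The series starts at the first power, so one factor \<open>z\<close> is split
    off.\<close>
  define g where "g z = (\<Sum>j. complex_of_real (a j) * z ^ j) * z" for z
  have a: "\<bar>a j\<bar> \<le> N" for j
  proof -
    have "\<bar>a j\<bar> = 1 / real (Suc j) * \<bar>\<tau> (Suc j)\<bar>" by (simp add: a_def abs_mult power_abs)
    also have "\<dots> \<le> 1 * \<bar>\<tau> (Suc j)\<bar>" by (intro mult_right_mono) auto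
    finally show ?thesis using assms[of "Suc j"] by simp
  qed
  have "(\<lambda>j. complex_of_real (a j) * (z - 0) ^ j) sums (\<Sum>j. complex_of_real (a j) * z ^ j)" if "z \<in> ball 0 1" for z
  proof -
    have "summable (\<lambda>j. \<bar>a j\<bar> * norm z ^ j)"
      using that a by (intro summable_bounded_power[of _ N]) auto
    then have "summable (\<lambda>j. complex_of_real (a j) * z ^ j)"
      by (intro summable_norm_cancel[of "\<lambda>j. complex_of_real (a j) * z ^ j"]) (simp add: norm_mult norm_power)
    then show ?thesis by (simp add: summable_sums)
  qed
  then have "(\<lambda>z. \<Sum>j. complex_of_real (a j) * z ^ j) holomorphic_on ball 0 1"
    by (rule power_series_holomorphic)
  then have "g holomorphic_on ball 0 1"
    unfolding g_def[abs_def] by (intro holomorphic_intros)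
  moreover have "g (of_real x) = complex_of_real (logdet_series \<tau> x)" if "\<bar>x\<bar> < 1" for x
  proof -
    have "summable (\<lambda>j. a j * x ^ j)" using a that by (rule summable_bounded_power)
    then have s: "(\<lambda>j. a j * x ^ j) sums (\<Sum>j. a j * x ^ j)" by (rule summable_sums)
    have "(\<lambda>j. complex_of_real (a j * x ^ j)) sums complex_of_real (\<Sum>j. a j * x ^ j)"
      using s by (simp only: sums_of_real_iff)
    then have "(\<Sum>j. complex_of_real (a j) * of_real x ^ j) = complex_of_real (\<Sum>j. a j * x ^ j)"
      by (simp add: sums_iff)
    moreover have "(\<lambda>j. a j * x ^ Suc j) sums ((\<Sum>j. a j * x ^ j) * x)"
      using sums_mult2[OF s, of x] by (simp add: mult_ac)
    then have "(\<Sum>j. a j * x ^ j) * x = logdet_series \<tau> x"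
      unfolding logdet_series_def a_def by (simp add: sums_iff)
    ultimately show ?thesis by (metis g_def of_real_mult)
  qed
  ultimately show ?thesis by (rule that)
qed

text \<open>Real parts of the complex Taylor coefficients serve as real coefficients, since the
  increments and the values of \<open>G\<close> on the real line are real.\<close>

lemma real_analytic_on_UNIV_I:
  assumes "\<And>x. \<exists>r>0. \<exists>G. G holomorphic_on ball (complex_of_real x) r \<and>
      (\<forall>y. \<bar>y - x\<bar> < r \<longrightarrow> G (of_real y) = of_real (f y))"
  shows "real_analytic_on f UNIV"
  unfolding real_analytic_on_def
proof
  fix x
  obtain r G where r: "r > 0" and G: "G holomorphic_on ball (complex_of_real x) r"
    and f: "\<And>y. \<bar>y - x\<bar> < r \<Longrightarrow> G (of_real y) = of_real (f y)"
    using assms[of x] by blast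
  define c where "c k = Re ((deriv ^^ k) G (of_real x) / fact k)" for k
  have "(\<lambda>k. c k * (y - x) ^ k) sums f y" if y: "\<bar>y - x\<bar> < r" for y
  proof -
    have "norm (complex_of_real x - of_real y) < r"
      using y by (metis abs_minus_commute norm_of_real of_real_diff)
    then have "(\<lambda>k. (deriv ^^ k) G (of_real x) / fact k * (of_real y - of_real x) ^ k) sums G (of_real y)"
      by (intro holomorphic_power_series[OF G]) (simp add: dist_norm)
    then have "(\<lambda>k. Re ((deriv ^^ k) G (of_real x) / fact k * (of_real y - of_real x) ^ k)) sums Re (G (of_real y))"
      by (simp add: sums_complex_iff)
    moreover have "Re (z * (of_real y - of_real x) ^ k) = Re z * (y - x) ^ k" for z k
      by (simp flip: of_real_diff of_real_power)
    ultimately show ?thesis by (simp only: f[OF y] c_def Re_complex_of_real)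
  qed
  then show "\<exists>r>0. \<exists>c. \<forall>y. \<bar>y - x\<bar> < r \<longrightarrow> (\<lambda>k. c k * (y - x) ^ k) sums f y"
    using r by blast
qed

text \<open>Near a real point \<open>cosh\<close> has positive real part, where \<open>Ln\<close> is
  holomorphic, and \<open>tanh\<close> stays in the unit disc, where the series converges. Both
  conditions are open.\<close>

lemma real_analytic_log_cosh_logdet:
  assumes "\<And>j. \<bar>\<tau> j\<bar> \<le> N"
  shows "real_analytic_on (\<lambda>t. ln (cosh t) + logdet_series \<tau> (tanh t)) UNIV"
proof (rule real_analytic_on_UNIV_I)
  fix x :: real
  obtain g where g: "g holomorphic_on ball 0 1" "\<And>x. \<bar>x\<bar> < 1 \<Longrightarrow> g (of_real x) = complex_of_real (logdet_series \<tau> x)"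
    using logdet_series_holomorphic[of \<tau> N] assms by blast
  have cosh_real: "cosh (complex_of_real t) = of_real (cosh t)" for t
    by (simp add: cosh_field_def flip: exp_of_real of_real_minus)
  have tanh_real: "tanh (complex_of_real t) = of_real (tanh t)" for t
    unfolding tanh_def cosh_real by (simp add: sinh_field_def flip: exp_of_real of_real_minus)
  have ct: "cosh (complex_of_real x) \<noteq> 0"
    unfolding cosh_real by (simp add: cosh_real_nonzero)
  have hc: "cosh holomorphic_on S" for S :: "complex set"
    by (simp add: cosh_field_def[abs_def]) (intro holomorphic_intros; simp)
  have "isCont cosh (complex_of_real x)"
    using holomorphic_on_imp_continuous_on[OF hc[of UNIV]] by (simp add: continuous_on_eq_continuous_at)
  then have "isCont (\<lambda>z. Re (cosh z)) (complex_of_real x)"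
    by (rule isCont_Re)
  then have ev1: "\<forall>\<^sub>F z in nhds (complex_of_real x). Re (cosh z) > 0"
    unfolding isCont_def tendsto_at_iff_tendsto_nhds[of "\<lambda>z. Re (cosh z)"]
    by (rule order_tendstoD) (simp add: cosh_real cosh_real_pos)
  have "isCont (\<lambda>z. norm (tanh z)) (complex_of_real x)"
    using ct by (intro continuous_intros)
  then have ev2: "\<forall>\<^sub>F z in nhds (complex_of_real x). norm (tanh z) < 1"
    unfolding isCont_def tendsto_at_iff_tendsto_nhds[of "\<lambda>z. norm (tanh z)"]
    by (rule order_tendstoD) (simp add: tanh_real tanh_abs_less_1)
  obtain r where r: "r > 0" "\<And>z. dist z (complex_of_real x) < r \<Longrightarrow> Re (cosh z) > 0 \<and> norm (tanh z) < 1"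
    using eventually_conj[OF ev1 ev2] unfolding eventually_nhds_metric by blast
  define G where "G z = Ln (cosh z) + g (tanh z)" for z
  have ball: "Re (cosh z) > 0" "norm (tanh z) < 1" if "z \<in> ball (complex_of_real x) r" for z
    using r(2)[of z] that by (auto simp: dist_commute)
  have nz: "cosh z \<noteq> 0" "cosh z \<notin> \<real>\<^sub>\<le>\<^sub>0" if "z \<in> ball (complex_of_real x) r" for z
    using ball(1)[OF that] by (auto simp: complex_nonpos_Reals_iff)
  have hs: "sinh holomorphic_on S" for S :: "complex set"
    by (simp add: sinh_field_def[abs_def]) (intro holomorphic_intros; simp)
  have ht: "tanh holomorphic_on ball (complex_of_real x) r"
    unfolding tanh_def[abs_def] using nz by (intro holomorphic_intros hc hs) auto
  have "(\<lambda>z. Ln (cosh z)) holomorphic_on ball (complex_of_real x) r"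
    using nz by (intro holomorphic_intros hc) auto
  moreover have "(g \<circ> tanh) holomorphic_on ball (complex_of_real x) r"
    by (rule holomorphic_on_compose_gen[OF ht g(1)]) (use ball in auto)
  ultimately have "G holomorphic_on ball (complex_of_real x) r"
    unfolding G_def[abs_def] o_def by (rule holomorphic_on_add)
  moreover have "G (of_real y) = of_real (ln (cosh y) + logdet_series \<tau> (tanh y))" for y
    using g(2)[OF tanh_abs_less_1[of y]] Ln_of_real[OF cosh_real_pos[of y]]
    by (simp add: G_def cosh_real tanh_real)
  ultimately show "\<exists>r>0. \<exists>G. G holomorphic_on ball (complex_of_real x) r \<and>
      (\<forall>y. \<bar>y - x\<bar> < r \<longrightarrow> G (of_real y) = of_real (ln (cosh y) + logdet_series \<tau> (tanh y)))"
    using r(1) by blast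
qed

section \<open>From finite volume to the infinite chain\<close>

context ising_couplings
begin

lemma gs_expect_diag_eq:
  assumes \<kappa>: "\<kappa> > 0" "h = \<kappa> * \<mu>" "J = - \<kappa> * \<nu>" and B: "B \<subseteq> box L"
  shows "gs_expect_diag J h L (\<lambda>s. exp (t * (\<Sum>i\<in>B. zval (s i))))
    = exp (real (card B) * ln (cosh t) + logdet_series (trace_pow B (A L)) (tanh t))"
proof -
  obtain v where v: "v \<in> ground_space J h L" "(\<Sum>s\<in>configs L. (v s)\<^sup>2) = 1"
    and E: "\<And>f. ground_energy J h L * (\<Sum>s\<in>configs L. (f s)\<^sup>2) \<le> (\<Sum>s\<in>configs L. f s * ham J h L f s)"
    using ground_state_exists[of J h L] by blast
  have rel: "maj_a L k v s + (\<Sum>j\<in>box L. A L k j * maj_b L j v s) = 0" if "k \<in> box L" "s \<in> configs L" for k s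
    using that v(1) by (intro ground_relation[OF \<kappa> _ E]) (auto simp: ground_space_def)
  have "gs_expect_diag J h L (\<lambda>s. exp (t * (\<Sum>i\<in>B. zval (s i))))
      = (\<Sum>s\<in>configs L. exp (t * (\<Sum>i\<in>B. zval (s i))) * (v s)\<^sup>2)"
    using ground_weight_eq[OF \<kappa> v] v(2) by (simp add: gs_expect_diag_def)
  also have "\<dots> = exp (real (card B) * ln (cosh t) + logdet_series (trace_pow B (A L)) (tanh t))"
    by (rule generating_function[OF B contractive_subset[OF A_contractive finite_box B] rel v(2)])
  finally show ?thesis .
qed

lemma eventually_block_in_box: "\<forall>\<^sub>F L in sequentially. {1..int n} \<subseteq> box L"
  using eventually_ge_at_top[of n] by (rule eventually_mono) (auto simp: box_def)

lemma bulk_trace_pow_tendsto: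
  "(\<lambda>L. trace_pow B (A L) j) \<longlonglongrightarrow> trace_pow B bulk.T j"
  unfolding trace_pow_def bulk.T_def[abs_def] by (intro tendsto_sum mpow_tendsto A_tendsto)

lemma eventually_trace_pow_le:
  "\<forall>\<^sub>F L in sequentially. \<forall>j. \<bar>trace_pow {1..int n} (A L) j\<bar> \<le> real n"
  using eventually_block_in_box[of n]
proof (rule eventually_mono, intro allI)
  fix L j assume "{1..int n} \<subseteq> box L"
  then have "contractive {1..int n} (A L)" by (rule contractive_subset[OF A_contractive finite_box])
  then show "\<bar>trace_pow {1..int n} (A L) j\<bar> \<le> real n"
    using trace_pow_le[of "{1..int n}" "A L" j] by simp
qed

text \<open>Inherited in the limit from the boxes, where blocks are compressions of orthogonal
  matrices. The bound is uniform in the power \<open>j\<close>, as the series in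
  \<open>tanh t\<close> requires.\<close>

lemma bulk_trace_pow_le: "\<bar>trace_pow {1..int n} bulk.T j\<bar> \<le> real n"
  by (rule tendsto_upperbound[OF tendsto_rabs[OF bulk_trace_pow_tendsto]])
    (use eventually_trace_pow_le[of n] in \<open>auto elim: eventually_mono\<close>)

text \<open>For a fixed block the finite-volume formula holds as soon as the box contains the block.
  The convergence shown here also guarantees that the \<open>lim\<close> in \<open>omega_exp\<close>
  is a genuine limit.\<close>

lemma omega_exp_eq:
  assumes \<kappa>: "\<kappa> > 0" "h = \<kappa> * \<mu>" "J = - \<kappa> * \<nu>"
  shows "omega_exp J h t n = exp (real n * ln (cosh t) + logdet_series (trace_pow {1..int n} bulk.T) (tanh t))"
proof -
  have "(\<lambda>L. exp (real n * ln (cosh t) + logdet_series (trace_pow {1..int n} (A L)) (tanh t)))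
      \<longlonglongrightarrow> exp (real n * ln (cosh t) + logdet_series (trace_pow {1..int n} bulk.T) (tanh t))"
    by (intro tendsto_intros logdet_series_tendsto[OF bulk_trace_pow_tendsto eventually_trace_pow_le tanh_abs_less_1]) simp
  moreover have "\<forall>\<^sub>F L in sequentially. exp (real n * ln (cosh t) + logdet_series (trace_pow {1..int n} (A L)) (tanh t))
      = gs_expect_diag J h L (\<lambda>s. exp (t * (\<Sum>i\<in>{1..int n}. zval (s i))))"
    using eventually_block_in_box[of n] by (rule eventually_mono) (simp add: gs_expect_diag_eq[OF \<kappa>])
  ultimately show ?thesis
    unfolding omega_exp_def by (intro limI) (rule Lim_transform_eventually)
qed

end

theorem theorem4:
  fixes J h :: real
  assumes "h \<noteq> 0" and "\<bar>J / h\<bar> < 1"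
  shows "\<exists>F :: real \<Rightarrow> real.
           (\<forall>t. (\<lambda>n. ln (omega_exp J h t n) / real n) \<longlonglongrightarrow> F t)
           \<and> real_analytic_on F UNIV"
proof -
  define \<kappa> where "\<kappa> = \<bar>h\<bar> + \<bar>J\<bar>"
  define \<mu> where "\<mu> = h / \<kappa>"
  \<comment> \<open>The sign makes both coefficients of the commutators carry the common factor
    \<open>- 2 * \<kappa>\<close>.\<close>
  define \<nu> where "\<nu> = - J / \<kappa>"
  have "\<kappa> > 0" using assms(1) by (simp add: \<kappa>_def add_pos_nonneg)
  then have \<kappa>: "\<kappa> > 0" "h = \<kappa> * \<mu>" "J = - \<kappa> * \<nu>"
    by (simp_all add: \<mu>_def \<nu>_def)
  have "\<bar>J\<bar> < \<bar>h\<bar>" using assms by (simp add: abs_divide divide_less_eq)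
  then interpret ising_couplings \<mu> \<nu>
    using \<kappa>(1) by unfold_locales (auto simp: \<mu>_def \<nu>_def abs_divide divide_strict_right_mono add_divide_distrib[symmetric] \<kappa>_def)
  define c where "c j = lim (\<lambda>n. trace_pow {1..int n} bulk.T j / real n)" for j
  have c: "(\<lambda>n. trace_pow {1..int n} bulk.T j / real n) \<longlonglongrightarrow> c j" for j
    unfolding c_def using bulk.trace_pow_average_convergent by (simp add: convergent_LIMSEQ_iff)
  have avg_le: "\<bar>trace_pow {1..int n} bulk.T j / real n\<bar> \<le> 1" for n j
    using bulk_trace_pow_le[of n j] by (auto simp: abs_divide divide_le_eq)
  \<comment> \<open>Gives the series in \<open>tanh t\<close> radius of convergence at least one,
    which covers all real \<open>t\<close>.\<close>
  have c_le: "\<bar>c j\<bar> \<le> 1" for j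
    by (rule tendsto_upperbound[OF tendsto_rabs[OF c]]) (simp_all add: avg_le del: abs_divide)
  have "(\<lambda>n. ln (omega_exp J h t n) / real n) \<longlonglongrightarrow> ln (cosh t) + logdet_series c (tanh t)" for t
  proof (rule Lim_transform_eventually)
    show "(\<lambda>n. ln (cosh t) + logdet_series (\<lambda>j. trace_pow {1..int n} bulk.T j / real n) (tanh t))
        \<longlonglongrightarrow> ln (cosh t) + logdet_series c (tanh t)"
      by (intro tendsto_intros logdet_series_tendsto[where N = 1] c)
        (simp_all add: avg_le tanh_abs_less_1 del: abs_divide)
    show "\<forall>\<^sub>F n in sequentially. ln (cosh t) + logdet_series (\<lambda>j. trace_pow {1..int n} bulk.T j / real n) (tanh t)
        = ln (omega_exp J h t n) / real n"
      \<comment> \<open>The case \<open>n = 0\<close>, where division by zero returns 0, is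
        excluded.\<close>
      using eventually_gt_at_top[of 0]
    proof (rule eventually_mono)
      fix n :: nat assume n: "n > 0"
      have "logdet_series (\<lambda>j. trace_pow {1..int n} bulk.T j / real n) (tanh t)
          = logdet_series (trace_pow {1..int n} bulk.T) (tanh t) / real n"
        by (rule logdet_series_divide[where N = "real n"]) (auto simp: bulk_trace_pow_le tanh_abs_less_1)
      then show "ln (cosh t) + logdet_series (\<lambda>j. trace_pow {1..int n} bulk.T j / real n) (tanh t)
          = ln (omega_exp J h t n) / real n"
        unfolding omega_exp_eq[OF \<kappa>] using n by (simp add: add_divide_distrib)
    qed
  qed
  moreover have "real_analytic_on (\<lambda>t. ln (cosh t) + logdet_series c (tanh t)) UNIV"
    using c_le by (rule real_analytic_log_cosh_logdet)
  ultimately show ?thesis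
    by (intro exI[of _ "\<lambda>t. ln (cosh t) + logdet_series c (tanh t)"]) blast
qed

end
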